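(* Let $n\ge 1$, let $G$ be a Young function for which there are constants $p^-,p^+$ with $1\le p^-\le \frac{t\,G'(t)}{G(t)}\le p^+<\infty$ for every $t>0$, and let $A\colon\mathbb{R}^n\to\mathbb{R}^n$ be a magnetic potential. If $u\in\bigcup_{s\in(0,1)}W^{s,G}_{A,0}(\mathbb{R}^n;\mathbb{C})$, then $$\lim_{s\downarrow 0}\, s\iint_{\mathbb{R}^n\times\mathbb{R}^n}G\left(\left|\frac{u(x)-e^{\mathrm{i}(x-y)\cdot A\left(\frac{x+y}{2}\right)}u(y)}{|x-y|^s}\right|\right)\frac{dx\,dy}{|x-y|^n}=\frac{2\,\omega_n}{n}\int_{\mathbb{R}^n}\overline{G}(|u(x)|)\,dx .$$
   Context: Young function: $G\colon[0,\infty)\to[0,\infty)$ of the form $G(t)=\int_0^t\phi(\tau)\,d\tau$, where $\phi\colon[0,\infty)\to[0,\infty)$ satisfies $\phi(0)=0$, $\phi(t)>0$ for $t>0$, $\phi$ is non-decreasing, right-continuous, and $\lim_{t\to+\infty}\phi(t)=+\infty$; $G'$ is understood as $\phi$. The associated function $\overline{G}\colon[0,\infty)\to[0,\infty)$ is $\overline{G}(t):=\int_0^t G(\tau)\,\frac{d\tau}{\tau}$. Magnetic potential: $A\colon\mathbb{R}^n\to\mathbb{R}^n$ is measurable and locally bounded. For $s\in(0,1)$ and measurable $u\colon\mathbb{R}^n\to\mathbb{C}$ put $$D^A_su(x,y):=\frac{u(x)-e^{\mathrm{i}(x-y)\cdot A\left(\frac{x+y}{2}\right)}u(y)}{|x-y|^s},\qquad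 I_G(u):=\int_{\mathbb{R}^n}G(|u(x)|)\,dx,\qquad I^A_{s,G}(u):=\iint_{\mathbb{R}^n\times\mathbb{R}^n}G(|D^A_su(x,y)|)\,\frac{dx\,dy}{|x-y|^n},$$ where $\mathrm{i}$ is the imaginary unit. Define $L^G(\mathbb{R}^n;\mathbb{C}):=\{u\colon\mathbb{R}^n\to\mathbb{C}\text{ measurable}: I_G(u)<\infty\}$ and $W^{s,G}_A(\mathbb{R}^n;\mathbb{C}):=\{u\in L^G(\mathbb{R}^n;\mathbb{C}): I^A_{s,G}(u)<\infty\}$ (functions identified when equal a.e.). The magnetic fractional Orlicz seminorm is $|u|^A_{s,G}:=\inf\{\lambda>0: I^A_{s,G}(u/\lambda)\le 1\}$. The space $W^{s,G}_{A,0}(\mathbb{R}^n;\mathbb{C})$ is the closure of $C_0^\infty(\mathbb{R}^n;\mathbb{C})$ (smooth, compactly supported functions) in $W^{s,G}_A(\mathbb{R}^n;\mathbb{C})$ with respect to the seminorm $|\cdot|^A_{s,G}$. The constant $\omega_n$ is normalized so that $\omega_n/n=|\mathbb{S}^{n-1}|$, the $(n-1)$-dimensional surface measure of the unit sphere of $\mathbb{R}^n$ (for $n=1$, $|\mathbb{S}^0|=2$). *)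

theory Defs
  imports "HOL-Analysis.Analysis"
begin

text \<open>The function \<open>\<phi>\<close> plays the role of \<open>G'\<close>; it is determined by \<open>G\<close> on \<open>[0,\<infinity>)\<close>, where it is
  the right derivative of \<open>G\<close>. Values of \<open>\<phi>\<close> and \<open>G\<close> at negative arguments are irrelevant.\<close>

definition young_function :: "(real \<Rightarrow> real) \<Rightarrow> (real \<Rightarrow> real) \<Rightarrow> bool" where
  "young_function \<phi> G \<longleftrightarrow>
     \<phi> 0 = 0 \<and> (\<forall>t>0. \<phi> t > 0) \<and> mono_on {0..} \<phi> \<and>
     (\<forall>t\<ge>0. continuous (at_right t) \<phi>) \<and> filterlim \<phi> at_top at_top \<and>
     (\<forall>t\<ge>0. G t = (LBINT \<tau>:{0..t}. \<phi> \<tau>))"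

definition assoc_young :: "(real \<Rightarrow> real) \<Rightarrow> real \<Rightarrow> real" where
  "assoc_young G t = (LBINT \<tau>:{0..t}. G \<tau> / \<tau>)"

definition magnetic_potential :: "(real ^ 'n \<Rightarrow> real ^ 'n) \<Rightarrow> bool" where
  "magnetic_potential A \<longleftrightarrow>
     A \<in> borel_measurable lebesgue \<and> (\<forall>x. \<exists>r>0. bounded (A ` ball x r))"

definition magnetic_quotient ::
    "(real ^ 'n \<Rightarrow> real ^ 'n) \<Rightarrow> real \<Rightarrow> (real ^ 'n \<Rightarrow> complex) \<Rightarrow> real ^ 'n \<Rightarrow> real ^ 'n \<Rightarrow> complex" where
  "magnetic_quotient A s u x y =
     (u x - exp (\<i> * complex_of_real ((x - y) \<bullet> A ((x + y) /\<^sub>R 2))) * u y) /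
     complex_of_real (norm (x - y) powr s)"

definition modular :: "(real \<Rightarrow> real) \<Rightarrow> (real ^ 'n \<Rightarrow> complex) \<Rightarrow> ennreal" where
  "modular G u = (\<integral>\<^sup>+ x. ennreal (G (norm (u x))) \<partial>lebesgue)"

text \<open>The double integral is taken with respect to Lebesgue measure on the product space
  \<open>\<real>\<^sup>n \<times> \<real>\<^sup>n\<close>, i.e. the completion of the product measure: for Lebesgue measurable \<open>A\<close> the
  integrand need not be measurable for the uncompleted product of the Lebesgue \<open>\<sigma>\<close>-algebras.\<close>

definition magnetic_modular ::
    "(real ^ 'n \<Rightarrow> real ^ 'n) \<Rightarrow> real \<Rightarrow> (real \<Rightarrow> real) \<Rightarrow> (real ^ 'n \<Rightarrow> complex) \<Rightarrow> ennreal" where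
  "magnetic_modular A s G u =
     (\<integral>\<^sup>+ (x, y). ennreal (G (norm (magnetic_quotient A s u x y)) / norm (x - y) ^ CARD('n))
        \<partial>(lebesgue :: ((real ^ 'n) \<times> (real ^ 'n)) measure))"

definition orlicz_class :: "(real \<Rightarrow> real) \<Rightarrow> (real ^ 'n \<Rightarrow> complex) set" where
  "orlicz_class G = {u. u \<in> borel_measurable lebesgue \<and> modular G u < \<infinity>}"

definition magnetic_space ::
    "(real ^ 'n \<Rightarrow> real ^ 'n) \<Rightarrow> real \<Rightarrow> (real \<Rightarrow> real) \<Rightarrow> (real ^ 'n \<Rightarrow> complex) set" where
  "magnetic_space A s G = {u \<in> orlicz_class G. magnetic_modular A s G u < \<infinity>}"

text \<open>Taking the infimum in \<^typ>\<open>ennreal\<close> makes the infimum of the empty set \<open>\<infinity>\<close>.\<close>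

definition magnetic_seminorm ::
    "(real ^ 'n \<Rightarrow> real ^ 'n) \<Rightarrow> real \<Rightarrow> (real \<Rightarrow> real) \<Rightarrow> (real ^ 'n \<Rightarrow> complex) \<Rightarrow> ennreal" where
  "magnetic_seminorm A s G u =
     (INF c \<in> {c. 0 < c \<and> magnetic_modular A s G (\<lambda>x. u x / complex_of_real c) \<le> 1}. ennreal c)"

primrec cont_diff :: "nat \<Rightarrow> (real ^ 'n \<Rightarrow> complex) \<Rightarrow> bool" where
  "cont_diff 0 f \<longleftrightarrow> continuous_on UNIV f"
| "cont_diff (Suc k) f \<longleftrightarrow>
     (\<forall>x. f differentiable (at x)) \<and> (\<forall>v. cont_diff k (\<lambda>x. frechet_derivative f (at x) v))"

definition test_functions :: "(real ^ 'n \<Rightarrow> complex) set" where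
  "test_functions = {f. (\<forall>k. cont_diff k f) \<and> compact (closure {x. f x \<noteq> 0})}"

definition magnetic_space0 ::
    "(real ^ 'n \<Rightarrow> real ^ 'n) \<Rightarrow> real \<Rightarrow> (real \<Rightarrow> real) \<Rightarrow> (real ^ 'n \<Rightarrow> complex) set" where
  "magnetic_space0 A s G =
     {u \<in> magnetic_space A s G.
        \<forall>\<epsilon>>0. \<exists>v\<in>test_functions. magnetic_seminorm A s G (\<lambda>x. u x - v x) < ennreal \<epsilon>}"

text \<open>Surface measure of a subset of the unit sphere of \<open>\<real>\<^sup>n\<close>, as given by integration in polar
  coordinates: \<open>n\<close> times the volume of the cone over the set with apex at the origin.\<close>

definition sphere_surface_measure :: "(real ^ 'n) set \<Rightarrow> real" where
  "sphere_surface_measure E =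
     real CARD('n) * measure lebesgue {r *\<^sub>R x | r x. 0 \<le> r \<and> r \<le> 1 \<and> x \<in> E}"

text \<open>Normalized so that \<open>\<omega>\<^sub>n / n\<close> is the surface measure of the unit sphere; this is not the
  volume of the unit ball.\<close>

definition omega :: "'n::finite itself \<Rightarrow> real" where
  "omega _ = real CARD('n) * sphere_surface_measure (sphere (0 :: real ^ 'n) 1)"

end

theory Submission
  imports Defs
begin

text \<open>
  Put \<open>h = |x - y|\<close>. For \<open>s \<le> s\<^sub>0\<close> the part \<open>h < 1\<close> of the double integral is dominated by the
  finite modular of order \<open>s\<^sub>0\<close>, and the part \<open>1 \<le> h < 2M\<close> by a multiple of \<open>\<integral>G(|u|)\<close>; after
  multiplication by \<open>s\<close> both vanish in the limit. For \<open>h \<ge> 2M\<close> one of \<open>x\<close>, \<open>y\<close> has norm at least \<open>M\<close>,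
  where \<open>u\<close> is small in the mean, so the almost additivity
  \<open>(1 - \<eta>) G(a + b) \<le> G(a) + K\<^sub>\<eta> G(b)\<close> allows the integrand to be replaced by
  \<open>G(|u(x)| / h\<^sup>s) + G(|u(y)| / h\<^sup>s)\<close> up to an error controlled by the tail of \<open>u\<close>. In polar
  coordinates the substitution \<open>\<tau> = t r\<^sup>-\<^sup>s\<close> gives
  \<open>s \<integral>\<^sub>1\<^sup>\<infinity> G(t r\<^sup>-\<^sup>s) dr / r = \<integral>\<^sub>0\<^sup>t G(\<tau>) d\<tau> / \<tau>\<close> exactly. Let \<open>s \<rightarrow> 0\<close>,
  then \<open>M \<rightarrow> \<infinity>\<close>, then \<open>\<eta> \<rightarrow> 0\<close>.
\<close>

section \<open>Young functions of finite upper index\<close>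

lemma young_functionD:
  assumes "young_function \<phi> G"
  shows "\<phi> 0 = 0" "0 < t \<Longrightarrow> 0 < \<phi> t" "mono_on {0..} \<phi>"
    "0 \<le> t \<Longrightarrow> G t = (LBINT \<tau>:{0..t}. \<phi> \<tau>)"
  using assms unfolding young_function_def by blast+

lemma young_derivative_props:
  assumes Y: "young_function \<phi> G" and st: "0 \<le> s" "s \<le> t"
  shows "0 \<le> \<phi> s" "\<phi> s \<le> \<phi> t"
proof -
  show "0 \<le> \<phi> s"
    using young_functionD(1)[OF Y] young_functionD(2)[OF Y, of s] st by (cases "s = 0") auto
  show "\<phi> s \<le> \<phi> t"
    using mono_onD[OF young_functionD(3)[OF Y], of s t] st by simp
qed

text \<open>Monotonicity is given only on the half-line from 0. Precomposing with
  \<open>max 0\<close> yields a globally monotone, hence Borel, function that agrees with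
  \<open>\<phi>\<close> on the interval and is bounded there by its value at
  \<open>b\<close>.\<close>

lemma young_integrable:
  assumes Y: "young_function \<phi> G" and "0 \<le> a"
  shows "set_integrable lborel {a..b} \<phi>"
proof -
  define \<psi> where "\<psi> t = \<phi> (max 0 t)" for t
  have "mono \<psi>"
    using young_derivative_props(2)[OF Y] by (auto simp: mono_def \<psi>_def max_def)
  then have [measurable]: "\<psi> \<in> borel_measurable borel"
    by (rule borel_measurable_mono)
  have "set_integrable lborel {a..b} \<psi>"
    unfolding set_integrable_def
  proof (rule integrableI_bounded_set_indicator[where B="\<psi> b"])
    show "AE t in lborel. t \<in> {a..b} \<longrightarrow> norm (\<psi> t) \<le> \<psi> b"
      using \<open>0 \<le> a\<close> young_derivative_props[OF Y] by (auto simp: \<psi>_def)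
  qed (auto simp: emeasure_lborel_Icc_eq)
  moreover have "indicator {a..b} t *\<^sub>R \<psi> t = indicator {a..b} t *\<^sub>R \<phi> t" for t :: real
    using \<open>0 \<le> a\<close> by (auto simp: \<psi>_def indicator_def)
  ultimately show ?thesis
    unfolding set_integrable_def by (simp only:)
qed

text \<open>Since \<open>\<phi>\<close> is monotone, its integral over \<open>{a<..b}\<close> lies
  between the length times either end value. This stands in for the mean value theorem, as
  \<open>\<phi>\<close> may jump.\<close>

lemma young_increment:
  assumes Y: "young_function \<phi> G" and ab: "0 \<le> a" "a \<le> b"
  shows "(b - a) * \<phi> a \<le> G b - G a" "G b - G a \<le> (b - a) * \<phi> b"
proof -
  have *: "set_integrable lborel {a<..b} \<phi>"
    by (rule set_integrable_subset[OF young_integrable[OF Y ab(1), of b]]) auto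
  have "{0..b} = {0..a} \<union> {a<..b}"
    using ab by auto
  then have "(LBINT \<tau>:{0..b}. \<phi> \<tau>) = (LBINT \<tau>:{0..a}. \<phi> \<tau>) + (LBINT \<tau>:{a<..b}. \<phi> \<tau>)"
    using set_integral_Un[of "{0..a}" "{a<..b}" lborel \<phi>, OF _ young_integrable[OF Y order_refl] *]
    by (simp add: ivl_disj_int)
  then have eq: "G b - G a = (LBINT \<tau>:{a<..b}. \<phi> \<tau>)"
    using young_functionD(4)[OF Y] ab by simp
  have const: "set_integrable lborel {a<..b} (\<lambda>_. c)" "(LBINT \<tau>:{a<..b}. c) = (b - a) * c" for c :: real
    using ab by (auto simp: set_integrable_def set_lebesgue_integral_def)
  have "(LBINT \<tau>:{a<..b}. \<phi> a) \<le> (LBINT \<tau>:{a<..b}. \<phi> \<tau>)"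
    using young_derivative_props[OF Y] ab by (intro set_integral_mono const *) auto
  then show "(b - a) * \<phi> a \<le> G b - G a"
    by (simp add: eq const)
  have "(LBINT \<tau>:{a<..b}. \<phi> \<tau>) \<le> (LBINT \<tau>:{a<..b}. \<phi> b)"
    using young_derivative_props[OF Y] ab by (intro set_integral_mono const *) auto
  then show "G b - G a \<le> (b - a) * \<phi> b"
    by (simp add: eq const)
qed

lemma young_zero:
  assumes "young_function \<phi> G"
  shows "G 0 = 0"
proof -
  have "AE \<tau> in lborel. indicator {0..0} \<tau> *\<^sub>R \<phi> \<tau> = 0"
    using AE_lborel_singleton[of "0::real"] by eventually_elim simp
  then have "(LBINT \<tau>:{0..0}. \<phi> \<tau>) = 0"
    unfolding set_lebesgue_integral_def by (rule integral_eq_zero_AE)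
  then show ?thesis
    using young_functionD(4)[OF assms order_refl] by simp
qed

lemma young_mono:
  assumes "young_function \<phi> G" "0 \<le> a" "a \<le> b"
  shows "G a \<le> G b"
proof -
  have "0 \<le> (b - a) * \<phi> a"
    using young_derivative_props(1)[OF assms] assms by simp
  then show ?thesis
    using young_increment(1)[OF assms] by simp
qed

lemma young_pos:
  assumes Y: "young_function \<phi> G" and t: "0 < t"
  shows "0 < G t"
proof -
  \<comment> \<open>On the whole interval from 0 the lower increment bound is trivial because
    \<open>\<phi> 0 = 0\<close>, so it is applied on the right half.\<close>
  have "0 < (t - t / 2) * \<phi> (t / 2)"
    using young_functionD(2)[OF Y, of "t / 2"] t by simp
  also have "\<dots> \<le> G t - G (t / 2)"
    using t by (intro young_increment[OF Y]) auto
  also have "\<dots> \<le> G t"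
    using young_mono[OF Y, of 0 "t / 2"] young_zero[OF Y] t by auto
  finally show ?thesis .
qed

text \<open>From \<open>l * t\<close> to \<open>t\<close> the slope of \<open>G\<close> is at most
  \<open>\<phi> t\<close>, and the upper index turns \<open>t * \<phi> t\<close> into
  \<open>pp * G t\<close>. The bound has content only for \<open>l\<close> near 1, where the left
  factor is positive.\<close>

lemma young_scaling:
  assumes Y: "young_function \<phi> G" and pp: "\<And>t. 0 < t \<Longrightarrow> t * \<phi> t / G t \<le> pp"
    and l: "0 \<le> l" "l \<le> 1" and t: "0 \<le> t"
  shows "(1 - pp * (1 - l)) * G t \<le> G (l * t)"
proof (cases "t = 0")
  case True
  then show ?thesis
    using young_zero[OF Y] by simp
next
  case False
  then have "0 < t"
    using t by simp
  then have "t * \<phi> t \<le> pp * G t"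
    using pp[of t] young_pos[OF Y, of t] by (simp add: field_simps)
  then have "(1 - l) * (t * \<phi> t) \<le> (1 - l) * (pp * G t)"
    using l by (intro mult_left_mono) auto
  moreover have "G t - G (l * t) \<le> (t - l * t) * \<phi> t"
    using l t by (intro young_increment[OF Y]) (auto simp: mult_left_le_one_le)
  ultimately show ?thesis
    by (simp add: algebra_simps)
qed

lemma young_div_le:
  assumes Y: "young_function \<phi> G" and ind: "1 \<le> t * \<phi> t / G t" and t: "0 < t"
  shows "G t / t \<le> \<phi> t"
  using ind young_pos[OF Y t] t by (simp add: field_simps)

text \<open>The lower index is at least 1, so \<open>G \<tau> / \<tau>\<close> is dominated by
  \<open>\<phi> \<tau>\<close>, whose integral is \<open>G\<close>. Hence the associated function is
  finite and its modular is controlled by that of \<open>G\<close>.\<close>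

lemma nn_integral_young_div_le:
  assumes Y: "young_function \<phi> G" and ind: "\<And>t. 0 < t \<Longrightarrow> 1 \<le> t * \<phi> t / G t" and t: "0 \<le> t"
  shows "(\<integral>\<^sup>+\<tau>. ennreal (G \<tau> / \<tau>) * indicator {0..t} \<tau> \<partial>lborel) \<le> ennreal (G t)"
proof -
  have "(\<integral>\<^sup>+\<tau>. ennreal (G \<tau> / \<tau>) * indicator {0..t} \<tau> \<partial>lborel) \<le>
        (\<integral>\<^sup>+\<tau>. ennreal (indicator {0..t} \<tau> *\<^sub>R \<phi> \<tau>) \<partial>lborel)"
  proof (rule nn_integral_mono)
    fix \<tau> :: real
    \<comment> \<open>At 0 both sides vanish: division by zero gives 0, and
      \<open>\<phi> 0 = 0\<close>.\<close>
    have "G \<tau> / \<tau> \<le> \<phi> \<tau>" if "0 \<le> \<tau>"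
      using young_div_le[OF Y ind, of \<tau>] young_functionD(1)[OF Y] that by (cases "\<tau> = 0") simp_all
    then show "ennreal (G \<tau> / \<tau>) * indicator {0..t} \<tau> \<le> ennreal (indicator {0..t} \<tau> *\<^sub>R \<phi> \<tau>)"
      by (simp add: indicator_def ennreal_leI)
  qed
  also have "\<dots> = ennreal (LBINT \<tau>:{0..t}. \<phi> \<tau>)"
    unfolding set_lebesgue_integral_def
    using young_integrable[OF Y order_refl, of t] young_derivative_props(1)[OF Y _ order_refl]
    by (intro nn_integral_eq_integral) (auto simp: set_integrable_def split: split_indicator)
  also have "\<dots> = ennreal (G t)"
    using young_functionD(4)[OF Y t] by simp
  finally show ?thesis .
qed

text \<open>The Bochner integral in \<open>assoc_young\<close> would default to 0 without
  integrability; domination by \<open>G t\<close> supplies it. The \<open>max 0\<close> makes the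
  integrand Borel, since \<open>G\<close> is arbitrary at negative arguments.\<close>

lemma assoc_young_eq_nn_integral:
  assumes Y: "young_function \<phi> G" and ind: "\<And>t. 0 < t \<Longrightarrow> 1 \<le> t * \<phi> t / G t" and t: "0 \<le> t"
  shows "ennreal (assoc_young G t) = (\<integral>\<^sup>+\<tau>. ennreal (G (max 0 \<tau>) / \<tau>) * indicator {0..t} \<tau> \<partial>lborel)"
    (is "_ = ?I")
proof -
  let ?f = "\<lambda>\<tau>. indicator {0..t} \<tau> * (G (max 0 \<tau>) / \<tau>)"
  have "mono (\<lambda>\<tau>. G (max 0 \<tau>))"
    using young_mono[OF Y] by (auto simp: mono_def max_def)
  then have [measurable]: "(\<lambda>\<tau>. G (max 0 \<tau>)) \<in> borel_measurable borel"
    by (rule borel_measurable_mono)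
  have nn: "0 \<le> ?f \<tau>" for \<tau> :: real
    using young_mono[OF Y, of 0 \<tau>] young_zero[OF Y] by (auto simp: indicator_def)
  have I: "?I = (\<integral>\<^sup>+\<tau>. ennreal (?f \<tau>) \<partial>lborel)"
    by (intro nn_integral_cong) (auto simp: indicator_def)
  have I': "?I = (\<integral>\<^sup>+\<tau>. ennreal (G \<tau> / \<tau>) * indicator {0..t} \<tau> \<partial>lborel)"
    by (intro nn_integral_cong) (auto simp: indicator_def)
  have "?I \<le> ennreal (G t)"
    unfolding I' by (rule nn_integral_young_div_le[OF Y ind t])
  then have "?I < \<infinity>"
    by (rule order.strict_trans1) simp
  then have "integrable lborel ?f"
    using nn by (intro integrableI_nonneg) (auto simp: I)
  then have "?I = ennreal (integral\<^sup>L lborel ?f)"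
    unfolding I using nn by (intro nn_integral_eq_integral) auto
  also have "integral\<^sup>L lborel ?f = assoc_young G t"
    unfolding assoc_young_def set_lebesgue_integral_def
    by (intro Bochner_Integration.integral_cong) (auto simp: indicator_def)
  finally show ?thesis ..
qed

section \<open>Radial integrals\<close>

text \<open>Continuity from below of the measure with density \<open>f\<close>.\<close>

lemma nn_integral_incseq_Union:
  assumes [measurable]: "f \<in> borel_measurable M" "\<And>i. A i \<in> sets M" and "incseq A"
  shows "(\<integral>\<^sup>+x. f x * indicator (\<Union>i. A i) x \<partial>M) = (SUP i. \<integral>\<^sup>+x. f x * indicator (A i) x \<partial>M)"
  using SUP_emeasure_incseq[of A "density M f"] assms
  by (simp add: emeasure_density image_subset_iff)

text \<open>This is the surface measure of the unit sphere.\<close>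

definition radial_const :: "'a::euclidean_space itself \<Rightarrow> real" where
  "radial_const _ = real DIM('a) * unit_ball_vol (real DIM('a))"

text \<open>Polar coordinates for radial functions. Both measures give a half-line
  \<open>{..x}\<close> the volume of the ball of radius \<open>max 0 x\<close>, and half-lines form
  an intersection-stable generator of the Borel sets.\<close>

lemma distr_lborel_norm:
  "distr (lborel :: 'a::euclidean_space measure) borel norm =
   density lborel (\<lambda>r. ennreal (radial_const TYPE('a) * r ^ (DIM('a) - 1)) * indicator {0..} r)"
  (is "?M = ?N")
proof (rule measure_eqI_generator_eq)
  let ?n = "DIM('a)"
  have M: "emeasure ?M {..x} = ennreal (unit_ball_vol (real ?n) * max 0 x ^ ?n)" for x
  proof -
    have "norm -` {..x} \<inter> space lborel = (if 0 \<le> x then cball (0::'a) x else {})"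
      by (auto simp: dist_norm intro: order_trans[OF norm_ge_zero])
    then show ?thesis
      by (simp add: emeasure_distr emeasure_cball)
  qed
  have N: "emeasure ?N {..x} = ennreal (unit_ball_vol (real ?n) * max 0 x ^ ?n)" for x
  proof -
    have "emeasure ?N {..x} =
        (\<integral>\<^sup>+r. ennreal (radial_const TYPE('a) * r ^ (?n - 1)) * indicator {0..x} r \<partial>lborel)"
      by (auto simp: emeasure_density indicator_def intro!: nn_integral_cong)
    also have "\<dots> = ennreal (unit_ball_vol (real ?n) * max 0 x ^ ?n)"
    proof (cases "0 \<le> x")
      case True
      have "(\<integral>\<^sup>+r. ennreal (radial_const TYPE('a) * r ^ (?n - 1)) * indicator {0..x} r \<partial>lborel) =
          ennreal (unit_ball_vol (real ?n) * x ^ ?n - unit_ball_vol (real ?n) * 0 ^ ?n)"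
        by (intro nn_integral_FTC_Icc)
           (use True in \<open>auto simp: radial_const_def intro!: derivative_eq_intros\<close>)
      then show ?thesis
        using True by simp
    qed (simp add: zero_power)
    finally show ?thesis .
  qed
  show "Int_stable (range (atMost :: real \<Rightarrow> real set))"
    by (auto simp: Int_stable_def)
  show "range (\<lambda>i. {..real i}) \<subseteq> range (atMost :: real \<Rightarrow> real set)"
    by auto
  show "(\<Union>i. {..real i}) = UNIV"
    by (auto intro: real_arch_simple)
  show "emeasure ?M {..real i} \<noteq> \<infinity>" for i
    by (simp add: M)
  show "emeasure ?M X = emeasure ?N X" if "X \<in> range atMost" for X
    using that M N by auto
  show "sets ?M = sigma_sets UNIV (range atMost)" "sets ?N = sigma_sets UNIV (range atMost)"
    by (simp_all add: borel_eq_atMost)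
qed simp

lemma nn_integral_radial:
  fixes f :: "real \<Rightarrow> ennreal"
  assumes [measurable]: "f \<in> borel_measurable borel"
  shows "(\<integral>\<^sup>+h. f (norm h) \<partial>(lborel :: 'a::euclidean_space measure)) =
    (\<integral>\<^sup>+r. ennreal (radial_const TYPE('a) * r ^ (DIM('a) - 1)) * indicator {0..} r * f r \<partial>lborel)"
proof -
  have "(\<integral>\<^sup>+h. f (norm h) \<partial>(lborel :: 'a measure)) = (\<integral>\<^sup>+r. f r \<partial>distr (lborel :: 'a measure) borel norm)"
    by (simp add: nn_integral_distr)
  then show ?thesis
    by (simp add: distr_lborel_norm nn_integral_density)
qed

text \<open>With \<open>\<tau> = t r\<^sup>-\<^sup>s\<close> the measure dr / r becomes d\<tau> / (s
  \<tau>), up to orientation. The substitution is made on the compact intervals \<open>B N\<close>,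
  whose images are \<open>A N\<close>, and extended by monotone convergence.\<close>

lemma nn_integral_powr_dilation:
  fixes g :: "real \<Rightarrow> real"
  assumes [measurable]: "g \<in> borel_measurable borel" and "g 0 = 0" and s: "0 < s" and t: "0 \<le> t"
  shows "(\<integral>\<^sup>+r. ennreal (g (t / r powr s) / r) * indicator {1..} r \<partial>lborel) =
    ennreal (1 / s) * (\<integral>\<^sup>+\<tau>. ennreal (g \<tau> / \<tau>) * indicator {0..t} \<tau> \<partial>lborel)"
proof (cases "t = 0")
  case True
  have "(\<integral>\<^sup>+\<tau>. ennreal (g \<tau> / \<tau>) * indicator {0..t} \<tau> \<partial>lborel) = (\<integral>\<^sup>+\<tau>. 0 \<partial>(lborel :: real measure))"
    by (intro nn_integral_cong) (auto simp: True indicator_def)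
  with True show ?thesis
    using \<open>g 0 = 0\<close> by simp
next
  case False
  then have t: "0 < t"
    using t by simp
  define f where "f \<tau> = g \<tau> / \<tau>" for \<tau>
  define A where "A N = {t / (1 + real N) powr s..t}" for N
  define B where "B N = {1..1 + real N}" for N
  have [measurable]: "f \<in> borel_measurable borel" "A N \<in> sets borel" "B N \<in> sets borel" for N
    by (auto simp: f_def[abs_def] A_def B_def)
  have step: "(\<integral>\<^sup>+r. ennreal (f (t / r powr s) * (t / r powr s) / r) * indicator (B N) r \<partial>lborel) =
      ennreal (1 / s) * (\<integral>\<^sup>+\<tau>. ennreal (f \<tau>) * indicator (A N) \<tau> \<partial>lborel)" for N
  proof -
    \<comment> \<open>The map from \<open>r\<close> to \<open>t / r powr s\<close> is decreasing,
      while the substitution rule wants a nonnegative derivative; hence the variable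
      \<open>x = - r\<close>, which is reflected back afterwards.\<close>
    let ?g = "\<lambda>x. t * (- x) powr (- s)" and ?g' = "\<lambda>x. t * s * (- x) powr (- s - 1)"
    have "(\<integral>\<^sup>+\<tau>. ennreal (f \<tau> * indicator {?g (- (1 + real N))..?g (- 1)} \<tau>) \<partial>lborel) =
        (\<integral>\<^sup>+x. ennreal (f (?g x) * ?g' x * indicator {- (1 + real N)..- 1} x) \<partial>lborel)"
    proof (rule nn_integral_substitution)
      show "(?g has_real_derivative ?g' x) (at x)" if "x \<in> {- (1 + real N)..- 1}" for x
        using that by (auto intro!: derivative_eq_intros simp: powr_diff field_simps)
      show "continuous_on {- (1 + real N)..- 1} ?g'"
        by (intro continuous_intros) auto
    qed (use t s in \<open>auto simp: set_borel_measurable_def\<close>)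
    also have "\<dots> = (\<integral>\<^sup>+r. ennreal (f (?g (0 + (- 1) * r)) * ?g' (0 + (- 1) * r) *
        indicator {- (1 + real N)..- 1} (0 + (- 1) * r)) \<partial>lborel)"
      by (subst nn_integral_real_affine[where c="-1" and t=0]) auto
    also have "\<dots> = (\<integral>\<^sup>+r. ennreal s * (ennreal (f (t / r powr s) * (t / r powr s) / r) * indicator (B N) r) \<partial>lborel)"
      by (intro nn_integral_cong)
         (use s in \<open>auto simp: B_def indicator_def powr_minus powr_diff field_simps ennreal_mult'[symmetric]\<close>)
    also have "\<dots> = ennreal s * (\<integral>\<^sup>+r. ennreal (f (t / r powr s) * (t / r powr s) / r) * indicator (B N) r \<partial>lborel)"
      by (rule nn_integral_cmult) measurable
    finally have *: "ennreal s * (\<integral>\<^sup>+r. ennreal (f (t / r powr s) * (t / r powr s) / r) * indicator (B N) r \<partial>lborel)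
      = (\<integral>\<^sup>+\<tau>. ennreal (f \<tau> * indicator {?g (- (1 + real N))..?g (- 1)} \<tau>) \<partial>lborel)" ..
    also have "\<dots> = (\<integral>\<^sup>+\<tau>. ennreal (f \<tau>) * indicator (A N) \<tau> \<partial>lborel)"
      by (intro nn_integral_cong) (auto simp: A_def indicator_def powr_minus field_simps)
    finally have "ennreal (1 / s) * (ennreal s * (\<integral>\<^sup>+r. ennreal (f (t / r powr s) * (t / r powr s) / r) * indicator (B N) r \<partial>lborel))
      = ennreal (1 / s) * (\<integral>\<^sup>+\<tau>. ennreal (f \<tau>) * indicator (A N) \<tau> \<partial>lborel)"
      by simp
    then show ?thesis
      using s by (simp add: mult.assoc[symmetric] ennreal_mult[symmetric])
  qed
  have UB: "(\<Union>N. B N) = {1..}"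
  proof (intro set_eqI iffI)
    fix r :: real assume "r \<in> {1..}"
    then show "r \<in> (\<Union>N. B N)"
      using real_arch_simple[of "r - 1"] by (auto simp: B_def algebra_simps)
  qed (auto simp: B_def)
  have UA: "(\<Union>N. A N) = {0<..t}"
  proof (intro set_eqI iffI)
    fix \<tau> assume "\<tau> \<in> (\<Union>N. A N)"
    then obtain N where "t / (1 + real N) powr s \<le> \<tau>" "\<tau> \<le> t"
      by (auto simp: A_def)
    moreover have "0 < t / (1 + real N) powr s"
      using t by simp
    ultimately show "\<tau> \<in> {0<..t}"
      by simp
  next
    \<comment> \<open>The left end point of \<open>A N\<close> falls below \<tau> once
      \<open>(1 + real N) powr s\<close> exceeds \<open>t / \<tau>\<close>, that is, once
      \<open>N\<close> exceeds its power of exponent \<open>1 / s\<close>.\<close>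
    fix \<tau> assume \<tau>: "\<tau> \<in> {0<..t}"
    obtain N where "(t / \<tau>) powr (1 / s) \<le> real N"
      using real_arch_simple by blast
    then have "((t / \<tau>) powr (1 / s)) powr s \<le> (1 + real N) powr s"
      using s by (intro powr_mono2) auto
    then have "t / \<tau> \<le> (1 + real N) powr s"
      using s \<tau> by (simp add: powr_powr)
    then have "t / (1 + real N) powr s \<le> \<tau>"
      using \<tau> by (simp add: field_simps)
    then show "\<tau> \<in> (\<Union>N. A N)"
      using \<tau> by (auto simp: A_def)
  qed
  have "incseq B"
    by (auto simp: incseq_def B_def)
  have "incseq A"
    using s t by (auto simp: incseq_def A_def intro!: divide_left_mono powr_mono2 elim!: order_trans[rotated])
  have "(\<integral>\<^sup>+r. ennreal (g (t / r powr s) / r) * indicator {1..} r \<partial>lborel) =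
      (\<integral>\<^sup>+r. ennreal (f (t / r powr s) * (t / r powr s) / r) * indicator {1..} r \<partial>lborel)"
    by (intro nn_integral_cong) (use t in \<open>auto simp: f_def indicator_def\<close>)
  also have "\<dots> = (SUP N. \<integral>\<^sup>+r. ennreal (f (t / r powr s) * (t / r powr s) / r) * indicator (B N) r \<partial>lborel)"
    unfolding UB[symmetric] by (rule nn_integral_incseq_Union) (use \<open>incseq B\<close> in auto)
  also have "\<dots> = ennreal (1 / s) * (SUP N. \<integral>\<^sup>+\<tau>. ennreal (f \<tau>) * indicator (A N) \<tau> \<partial>lborel)"
    unfolding step by (simp add: SUP_mult_left_ennreal)
  also have "(SUP N. \<integral>\<^sup>+\<tau>. ennreal (f \<tau>) * indicator (A N) \<tau> \<partial>lborel) =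
      (\<integral>\<^sup>+\<tau>. ennreal (f \<tau>) * indicator {0<..t} \<tau> \<partial>lborel)"
    unfolding UA[symmetric] by (rule nn_integral_incseq_Union[symmetric]) (use \<open>incseq A\<close> in auto)
  \<comment> \<open>The point 0 missing from the union contributes nothing, since division by zero
    gives \<open>f 0 = 0\<close>.\<close>
  also have "\<dots> = (\<integral>\<^sup>+\<tau>. ennreal (g \<tau> / \<tau>) * indicator {0..t} \<tau> \<partial>lborel)"
    by (intro nn_integral_cong) (auto simp: f_def indicator_def)
  finally show ?thesis .
qed

text \<open>The weight of order \<open>- DIM('a)\<close> cancels the polar density down to dr / r,
  so the dimension survives only in \<open>radial_const\<close>.\<close>

lemma nn_integral_radial_powr:
  fixes g :: "real \<Rightarrow> real"
  assumes [measurable]: "g \<in> borel_measurable borel" and g0: "g 0 = 0" and st: "0 < s" "0 \<le> t"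
  shows "(\<integral>\<^sup>+h. ennreal (g (t / norm h powr s) / norm h ^ DIM('a)) * indicator {1..} (norm h)
      \<partial>(lborel :: 'a::euclidean_space measure)) =
    ennreal (radial_const TYPE('a) / s) * (\<integral>\<^sup>+\<tau>. ennreal (g \<tau> / \<tau>) * indicator {0..t} \<tau> \<partial>lborel)"
    (is "?L = _")
proof -
  have nn: "0 \<le> radial_const TYPE('a)"
    by (simp add: radial_const_def)
  have pow: "r ^ DIM('a) = r * r ^ (DIM('a) - 1)" for r :: real
    using DIM_positive[where 'a='a] by (cases "DIM('a)") auto
  have "?L = (\<integral>\<^sup>+r. ennreal (radial_const TYPE('a) * r ^ (DIM('a) - 1)) * indicator {0..} r *
      (ennreal (g (t / r powr s) / r ^ DIM('a)) * indicator {1..} r) \<partial>lborel)"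
    by (rule nn_integral_radial) measurable
  also have "\<dots> = (\<integral>\<^sup>+r. ennreal (radial_const TYPE('a)) *
      (ennreal (g (t / r powr s) / r) * indicator {1..} r) \<partial>lborel)"
    by (intro nn_integral_cong)
       (use nn in \<open>auto simp: indicator_def pow ennreal_mult'[symmetric]\<close>)
  also have "\<dots> = ennreal (radial_const TYPE('a)) *
      (\<integral>\<^sup>+r. ennreal (g (t / r powr s) / r) * indicator {1..} r \<partial>lborel)"
    by (rule nn_integral_cmult) measurable
  also have "\<dots> = ennreal (radial_const TYPE('a) / s) *
      (\<integral>\<^sup>+\<tau>. ennreal (g \<tau> / \<tau>) * indicator {0..t} \<tau> \<partial>lborel)"
    using nn st by (subst nn_integral_powr_dilation)
      (simp_all add: g0 mult.assoc[symmetric] ennreal_mult[symmetric])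
  finally show ?thesis .
qed

section \<open>Null sets, difference variables and almost bounds\<close>

text \<open>The real-valued case is applied to each coordinate; the finitely many exceptional null
  sets are then merged.\<close>

lemma completion_ex_borel_measurable_euclidean:
  fixes f :: "'a \<Rightarrow> 'b::euclidean_space"
  assumes "f \<in> borel_measurable (completion M)"
  obtains g where "g \<in> borel_measurable M" "AE x in M. f x = g x"
proof -
  have "\<forall>b. \<exists>g\<in>borel_measurable M. AE x in M. f x \<bullet> b = g x"
  proof
    fix b
    have "(\<lambda>x. f x \<bullet> b) \<in> borel_measurable (completion M)"
      using assms by measurable
    then show "\<exists>g\<in>borel_measurable M. AE x in M. f x \<bullet> b = g x"
      by (rule completion_ex_borel_measurable_real)
  qed
  then obtain g where [measurable]: "\<And>b. g b \<in> borel_measurable M"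
    and g: "\<And>b. AE x in M. f x \<bullet> b = g b x"
    by metis
  have "AE x in M. \<forall>b\<in>Basis. f x \<bullet> b = g b x"
    using g by (simp add: AE_finite_allI)
  then have "AE x in M. f x = (\<Sum>b\<in>Basis. g b x *\<^sub>R b)"
    by eventually_elim (metis (no_types, lifting) euclidean_representation sum.cong)
  moreover have "(\<lambda>x. \<Sum>b\<in>Basis. g b x *\<^sub>R b) \<in> borel_measurable M"
    by measurable
  ultimately show ?thesis
    by (rule that[rotated])
qed

lemma AE_lborel_affine:
  fixes t :: "'a::euclidean_space"
  assumes N: "N \<in> null_sets lborel" and c: "c \<noteq> 0"
  shows "AE x in lborel. t + c *\<^sub>R x \<notin> N"
proof -
  have [measurable]: "N \<in> sets borel"
    using N by auto
  have "AE x in lborel. x \<notin> N"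
    using N by (rule AE_not_in)
  then have "AE x in density (distr lborel borel (\<lambda>x. t + c *\<^sub>R x)) (\<lambda>_. ennreal (\<bar>c\<bar> ^ DIM('a))). x \<notin> N"
    by (subst lborel_affine[OF c, of t, symmetric])
  then show ?thesis
    using c by (simp add: AE_density AE_distr_iff)
qed

text \<open>The potential is evaluated at midpoints, so changing it on a null set must not affect
  almost every pair. For fixed \<open>x\<close>, the \<open>y\<close> whose midpoint with
  \<open>x\<close> lies in \<open>N\<close> form an affine image of \<open>N\<close>, again null;
  Fubini does the rest.\<close>

lemma AE_lborel_pair_avoids:
  fixes N :: "'a::euclidean_space set"
  assumes N: "N \<in> null_sets lborel"
  shows "AE p in lborel. fst p \<notin> N \<and> snd p \<notin> N \<and> (fst p + snd p) /\<^sub>R 2 \<notin> N"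
proof -
  have [measurable]: "N \<in> sets borel"
    using N by auto
  have "AE x in lborel. AE y in lborel. x \<notin> N \<and> y \<notin> N \<and> (x + y) /\<^sub>R 2 \<notin> N"
    using AE_not_in[OF N]
  proof eventually_elim
    fix x assume x: "x \<notin> N"
    have "AE y in lborel. (1/2) *\<^sub>R x + (1/2) *\<^sub>R y \<notin> N"
      by (rule AE_lborel_affine[OF N]) simp
    with AE_not_in[OF N] show "AE y in lborel. x \<notin> N \<and> y \<notin> N \<and> (x + y) /\<^sub>R 2 \<notin> N"
      by eventually_elim (use x in \<open>simp add: scaleR_add_right\<close>)
  qed
  moreover have "{p \<in> space (lborel \<Otimes>\<^sub>M lborel). fst p \<notin> N \<and> snd p \<notin> N \<and> (fst p + snd p) /\<^sub>R 2 \<notin> N}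
      \<in> sets (lborel \<Otimes>\<^sub>M lborel)"
    by measurable
  ultimately have "AE p in lborel \<Otimes>\<^sub>M lborel. fst p \<notin> N \<and> snd p \<notin> N \<and> (fst p + snd p) /\<^sub>R 2 \<notin> N"
    using lborel_pair.AE_pair_measure[where P="\<lambda>p. fst p \<notin> N \<and> snd p \<notin> N \<and> (fst p + snd p) /\<^sub>R 2 \<notin> N"]
    by simp
  then show ?thesis
    by (simp only: lborel_prod)
qed

text \<open>Tonelli with the variable inside \<open>f\<close> outermost, then translation invariance
  in the inner integral. Exchanging the order of integration makes both endpoints give the same
  value.\<close>

lemma nn_integral_pair_norm_diff:
  fixes f :: "'a::euclidean_space \<Rightarrow> real \<Rightarrow> ennreal"
  assumes [measurable]: "case_prod f \<in> borel_measurable borel"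
  shows "(\<integral>\<^sup>+p. f (fst p) (norm (fst p - snd p)) \<partial>(lborel :: ('a \<times> 'a) measure)) =
      (\<integral>\<^sup>+x. \<integral>\<^sup>+h. f x (norm (h::'a)) \<partial>lborel \<partial>lborel)"
    and "(\<integral>\<^sup>+p. f (snd p) (norm (fst p - snd p)) \<partial>(lborel :: ('a \<times> 'a) measure)) =
      (\<integral>\<^sup>+x. \<integral>\<^sup>+h. f x (norm (h::'a)) \<partial>lborel \<partial>lborel)"
proof -
  have [measurable]: "case_prod f \<in> borel_measurable (borel \<Otimes>\<^sub>M borel)"
    using assms by (simp add: borel_prod)
  have shift: "(\<integral>\<^sup>+y. f x (norm (y - x)) \<partial>lborel) = (\<integral>\<^sup>+h. f x (norm (h::'a)) \<partial>lborel)" for x :: 'a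
  proof -
    have [measurable]: "f x \<in> borel_measurable borel"
      using measurable_compose[OF measurable_Pair1' \<open>case_prod f \<in> borel_measurable (borel \<Otimes>\<^sub>M borel)\<close>, of x]
      by simp
    have "(\<integral>\<^sup>+y. f x (norm (y - x)) \<partial>lborel) = (\<integral>\<^sup>+y. f x (norm (y - x)) \<partial>distr lborel borel ((+) x))"
      by (simp add: lborel_distr_plus)
    also have "\<dots> = (\<integral>\<^sup>+h. f x (norm (x + h - x)) \<partial>lborel)"
      by (rule nn_integral_distr) measurable
    finally show ?thesis
      by simp
  qed
  have shift': "(\<integral>\<^sup>+y. f x (norm (x - y)) \<partial>lborel) = (\<integral>\<^sup>+h. f x (norm (h::'a)) \<partial>lborel)" for x :: 'a
    using shift[of x] by (simp only: norm_minus_commute)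
  show "(\<integral>\<^sup>+p. f (fst p) (norm (fst p - snd p)) \<partial>(lborel :: ('a \<times> 'a) measure)) =
      (\<integral>\<^sup>+x. \<integral>\<^sup>+h. f x (norm (h::'a)) \<partial>lborel \<partial>lborel)"
    unfolding lborel_prod[symmetric]
    by (subst lborel.nn_integral_fst[symmetric]) (simp_all add: shift')
  show "(\<integral>\<^sup>+p. f (snd p) (norm (fst p - snd p)) \<partial>(lborel :: ('a \<times> 'a) measure)) =
      (\<integral>\<^sup>+x. \<integral>\<^sup>+h. f x (norm (h::'a)) \<partial>lborel \<partial>lborel)"
    unfolding lborel_prod[symmetric]
    by (subst lborel_pair.nn_integral_snd[symmetric]) (simp_all add: shift)
qed

text \<open>Dominated convergence: every fixed point eventually leaves the exterior region.\<close>

lemma nn_integral_tail_tendsto_0: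
  fixes f :: "'a::euclidean_space \<Rightarrow> ennreal"
  assumes [measurable]: "f \<in> borel_measurable borel" and fin: "(\<integral>\<^sup>+x. f x \<partial>lborel) < \<infinity>"
  shows "(\<lambda>N. \<integral>\<^sup>+x. f x * indicator {x. real N \<le> norm x} x \<partial>lborel) \<longlonglongrightarrow> 0"
proof -
  have "(\<lambda>N. \<integral>\<^sup>+x. f x * indicator {x. real N \<le> norm x} x \<partial>lborel) \<longlonglongrightarrow> (\<integral>\<^sup>+x. 0 \<partial>(lborel :: 'a measure))"
  proof (rule nn_integral_dominated_convergence[where w=f])
    show "AE x in lborel. (\<lambda>N. f x * indicator {x. real N \<le> norm x} x) \<longlonglongrightarrow> 0"
    proof (intro AE_I2 tendsto_eventually)
      fix x :: 'a
      obtain n where "norm x < real n"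
        using reals_Archimedean2 by blast
      then show "\<forall>\<^sub>F N in sequentially. f x * indicator {x. real N \<le> norm x} x = 0"
        by (intro eventually_sequentiallyI[of n]) auto
    qed
  qed (use fin in \<open>auto split: split_indicator\<close>)
  then show ?thesis
    by simp
qed

text \<open>A multiplicative loss \<eta> and an additive loss \<epsilon> in both directions are
  harmless when both can be made arbitrarily small, because the limit is finite.\<close>

lemma tendsto_of_almost_bounds:
  fixes e :: "'b \<Rightarrow> real"
  assumes l: "0 \<le> l"
    and ev: "\<And>\<eta> \<epsilon>. 0 < \<eta> \<Longrightarrow> \<eta> < 1 \<Longrightarrow> 0 < \<epsilon> \<Longrightarrow>
      \<forall>\<^sub>F s in F. (1 - \<eta>) * e s \<le> l + \<epsilon> \<and> (1 - \<eta>) * l \<le> e s + \<epsilon>"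
  shows "(e \<longlongrightarrow> l) F"
proof (rule order_tendstoI)
  fix a assume a: "a < l"
  \<comment> \<open>Chosen so that \<open>\<eta> * l\<close> and the additive error each use a
    quarter of the gap. The summand 1 avoids a zero denominator, and the minimum keeps \<eta> below
    1.\<close>
  define \<eta> where "\<eta> = min (1/2) ((l - a) / (4 * (l + 1)))"
  have \<eta>: "0 < \<eta>" "\<eta> < 1"
    using a l by (auto simp: \<eta>_def)
  have "\<eta> * l \<le> (l - a) / (4 * (l + 1)) * (l + 1)"
    using a l by (intro mult_mono) (auto simp: \<eta>_def)
  also have "\<dots> = (l - a) / 4"
    using l by (simp add: field_simps)
  finally have *: "\<eta> * l \<le> (l - a) / 4" .
  have "\<forall>\<^sub>F s in F. (1 - \<eta>) * e s \<le> l + (l - a) / 4 \<and> (1 - \<eta>) * l \<le> e s + (l - a) / 4"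
    using a by (intro ev \<eta>) auto
  then show "\<forall>\<^sub>F s in F. a < e s"
  proof eventually_elim
    fix s assume "(1 - \<eta>) * e s \<le> l + (l - a) / 4 \<and> (1 - \<eta>) * l \<le> e s + (l - a) / 4"
    then have "l - \<eta> * l \<le> e s + (l - a) / 4"
      by (simp add: left_diff_distrib)
    then show "a < e s"
      using * a by argo
  qed
next
  fix a assume a: "l < a"
  \<comment> \<open>Here the loss is measured against \<open>a\<close>: comparing
    \<open>(1 - \<eta>) * e s\<close> with \<open>(1 - \<eta>) * a\<close> avoids any a priori bound
    on \<open>e s\<close>.\<close>
  define \<eta> where "\<eta> = min (1/2) ((a - l) / (4 * (a + 1)))"
  have \<eta>: "0 < \<eta>" "\<eta> < 1"
    using a l by (auto simp: \<eta>_def)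
  have "\<eta> * a \<le> (a - l) / (4 * (a + 1)) * (a + 1)"
    using a l by (intro mult_mono) (auto simp: \<eta>_def)
  also have "\<dots> = (a - l) / 4"
    using l a by (simp add: field_simps)
  finally have *: "\<eta> * a \<le> (a - l) / 4" .
  have "\<forall>\<^sub>F s in F. (1 - \<eta>) * e s \<le> l + (a - l) / 4 \<and> (1 - \<eta>) * l \<le> e s + (a - l) / 4"
    using a by (intro ev \<eta>) auto
  then show "\<forall>\<^sub>F s in F. e s < a"
  proof eventually_elim
    fix s assume "(1 - \<eta>) * e s \<le> l + (a - l) / 4 \<and> (1 - \<eta>) * l \<le> e s + (a - l) / 4"
    moreover have "(1 - \<eta>) * a = a - \<eta> * a"
      by (simp add: left_diff_distrib)
    ultimately have "(1 - \<eta>) * e s < (1 - \<eta>) * a"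
      using * a by argo
    then show "e s < a"
      using \<eta> by simp
  qed
qed

section \<open>The limit for a doubling function\<close>

text \<open>The scaling hypothesis is what \<open>t G'(t) \<le> C G(t)\<close> gives in a single step, since
  \<open>G(t) - G(l t) \<le> (1 - l) t G'(t)\<close>; the power bound \<open>G(l t) \<ge> l\<^sup>C G(t)\<close> is not needed.\<close>

locale doubling =
  fixes G :: "real \<Rightarrow> real" and C :: real
  assumes mono: "mono G" and zero [simp]: "G 0 = 0" and C: "1 \<le> C"
    and scaling: "\<And>l t. 0 \<le> l \<Longrightarrow> l \<le> 1 \<Longrightarrow> 0 \<le> t \<Longrightarrow> (1 - C * (1 - l)) * G t \<le> G (l * t)"
begin

section \<open>Doubling and almost subadditivity\<close>

lemma measurable_G [measurable]: "G \<in> borel_measurable borel"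
  using mono by (rule borel_measurable_mono)

lemma nonneg: "0 \<le> t \<Longrightarrow> 0 \<le> G t"
  using monoD[OF mono, of 0 t] by simp

lemma dilation_bound:
  assumes d: "0 < d"
  obtains K where "0 \<le> K" "\<And>t. 0 \<le> t \<Longrightarrow> G (t / d) \<le> K * G t"
proof -
  \<comment> \<open>This makes the scaling factor \<open>1 - C * (1 - l)\<close> equal to one half,
    so shrinking the argument by \<open>l\<close> costs at most a factor 2. Iterating until
    \<open>l ^ k < d\<close> gives \<open>K = 2 ^ k\<close>.\<close>
  define l where "l = 1 - 1 / (2 * C)"
  have l: "0 < l" "l < 1"
    using C by (auto simp: l_def field_simps)
  have half: "G t \<le> 2 * G (l * t)" if "0 \<le> t" for t
    using scaling[of l t] l that C by (simp add: l_def)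
  have iter: "G t \<le> 2 ^ k * G (l ^ k * t)" if "0 \<le> t" for k t
  proof (induction k)
    case (Suc k)
    have "G (l ^ k * t) \<le> 2 * G (l * (l ^ k * t))"
      using l that by (intro half) auto
    then have "2 ^ k * G (l ^ k * t) \<le> 2 ^ k * (2 * G (l * (l ^ k * t)))"
      by (rule mult_left_mono) simp
    with Suc have "G t \<le> 2 ^ k * (2 * G (l * (l ^ k * t)))"
      by (rule order_trans)
    then show ?case
      by (simp add: mult_ac)
  qed simp
  obtain k where k: "l ^ k < d"
    using real_arch_pow_inv[OF d l(2)] by blast
  show ?thesis
  proof (rule that)
    fix t :: real assume t: "0 \<le> t"
    have "G (t / d) \<le> 2 ^ k * G (l ^ k * (t / d))"
      using t d by (intro iter) auto
    also have "l ^ k * (t / d) \<le> d * (t / d)"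
      using t d k by (intro mult_right_mono) auto
    then have "2 ^ k * G (l ^ k * (t / d)) \<le> 2 ^ k * G t"
      using d by (intro mult_left_mono monoD[OF mono]) auto
    finally show "G (t / d) \<le> 2 ^ k * G t" .
  qed simp
qed

text \<open>If \<open>b\<close> is a small fraction of \<open>a + b\<close>, scaling down to
  \<open>a\<close> loses only the factor \<open>1 - \<eta>\<close>; otherwise \<open>a + b\<close>
  is at most a fixed multiple of \<open>b\<close>. The large constant thus falls on
  \<open>G b\<close> alone.\<close>

lemma almost_subadditive:
  assumes \<eta>: "0 < \<eta>" "\<eta> < 1"
  obtains K where "0 \<le> K" "\<forall>a\<ge>0. \<forall>b\<ge>0. (1 - \<eta>) * G (a + b) \<le> G a + K * G b"
proof -
  \<comment> \<open>With this threshold the scaling loss \<open>C * d\<close> is exactly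
    \<eta>.\<close>
  define d where "d = \<eta> / C"
  have d: "0 < d" "d < 1"
    using \<eta> C by (auto simp: d_def field_simps)
  obtain K where K: "0 \<le> K" "\<And>t. 0 \<le> t \<Longrightarrow> G (t / d) \<le> K * G t"
    using dilation_bound[OF d(1)] by blast
  show ?thesis
  proof (rule that[OF K(1)], intro allI impI)
    fix a b :: real assume ab: "0 \<le> a" "0 \<le> b"
    have nn: "0 \<le> G a" "0 \<le> K * G b" "0 \<le> G (a + b)"
      using ab K(1) nonneg by auto
    show "(1 - \<eta>) * G (a + b) \<le> G a + K * G b"
    proof (cases "b \<le> d * (a + b)")
      case True
      have "(1 - \<eta>) * G (a + b) \<le> G ((1 - d) * (a + b))"
        using scaling[of "1 - d" "a + b"] d ab C by (simp add: d_def)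
      also have "\<dots> \<le> G a"
        using True by (intro monoD[OF mono]) (simp add: algebra_simps)
      finally show ?thesis
        using nn by simp
    next
      case False
      have "(1 - \<eta>) * G (a + b) \<le> G (a + b)"
        using \<eta> nn by (simp add: mult_left_le_one_le)
      also have "\<dots> \<le> G (b / d)"
        using False d by (intro monoD[OF mono]) (simp add: field_simps)
      also have "\<dots> \<le> K * G b"
        by (rule K(2)[OF ab(2)])
      finally show ?thesis
        using nn by simp
    qed
  qed
qed

section \<open>The associated function and integrals over ranges of distance\<close>

definition Gbar :: "real \<Rightarrow> ennreal" where
  "Gbar t = (\<integral>\<^sup>+\<tau>. ennreal (G \<tau> / \<tau>) * indicator {0..t} \<tau> \<partial>lborel)"

lemma measurable_Gbar [measurable]: "Gbar \<in> borel_measurable borel"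
proof -
  \<comment> \<open>The interval is rewritten as a condition on the pair of \<tau> and
    \<open>t\<close>, which exhibits joint measurability of the integrand.\<close>
  have "Gbar = (\<lambda>t. \<integral>\<^sup>+\<tau>. (if 0 \<le> \<tau> \<and> \<tau> \<le> t then ennreal (G \<tau> / \<tau>) else 0) \<partial>lborel)"
    by (auto simp: Gbar_def indicator_def fun_eq_iff intro!: nn_integral_cong)
  also have "\<dots> \<in> borel_measurable borel"
    by measurable
  finally show ?thesis .
qed

text \<open>For a fixed endpoint the radial formula evaluates the inner integral exactly, for every
  positive \<open>s\<close>. The set \<open>S\<close> will be either the whole space or the exterior
  of a ball.\<close>

lemma nn_integral_far_field:
  fixes U :: "'a::euclidean_space \<Rightarrow> real"
  assumes [measurable]: "U \<in> borel_measurable borel" "S \<in> sets borel"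
    and U: "\<And>x. 0 \<le> U x" and s: "0 < s"
  defines "k \<equiv> \<lambda>x r. ennreal (G (U x / r powr s) / r ^ DIM('a)) * indicator {1..} r * indicator S x"
  shows "(\<integral>\<^sup>+p. k (fst p) (norm (fst p - snd p)) \<partial>lborel) =
      ennreal (radial_const TYPE('a) / s) * (\<integral>\<^sup>+x. Gbar (U x) * indicator S x \<partial>lborel)"
    and "(\<integral>\<^sup>+p. k (snd p) (norm (fst p - snd p)) \<partial>lborel) =
      ennreal (radial_const TYPE('a) / s) * (\<integral>\<^sup>+x. Gbar (U x) * indicator S x \<partial>lborel)"
proof -
  have k [measurable]: "case_prod k \<in> borel_measurable borel"
    unfolding k_def borel_prod[symmetric] by measurable
  have "(\<integral>\<^sup>+h. k x (norm h) \<partial>(lborel :: 'a measure)) =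
      ennreal (radial_const TYPE('a) / s) * (Gbar (U x) * indicator S x)" for x
    unfolding k_def Gbar_def
    by (subst nn_integral_multc)
      (use nn_integral_radial_powr[OF measurable_G zero s U, where 'a='a] in \<open>simp_all add: mult.assoc\<close>)
  then have I: "(\<integral>\<^sup>+x. \<integral>\<^sup>+h. k x (norm (h::'a)) \<partial>lborel \<partial>lborel) =
      ennreal (radial_const TYPE('a) / s) * (\<integral>\<^sup>+x. Gbar (U x) * indicator S x \<partial>lborel)"
    by (simp add: nn_integral_cmult)
  show "(\<integral>\<^sup>+p. k (fst p) (norm (fst p - snd p)) \<partial>lborel) =
      ennreal (radial_const TYPE('a) / s) * (\<integral>\<^sup>+x. Gbar (U x) * indicator S x \<partial>lborel)"
    using nn_integral_pair_norm_diff(1)[OF k] I by simp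
  show "(\<integral>\<^sup>+p. k (snd p) (norm (fst p - snd p)) \<partial>lborel) =
      ennreal (radial_const TYPE('a) / s) * (\<integral>\<^sup>+x. Gbar (U x) * indicator S x \<partial>lborel)"
    using nn_integral_pair_norm_diff(2)[OF k] I by simp
qed

text \<open>Each point has partners only in a ball of radius \<open>R\<close>, so each endpoint
  contributes the modular times a finite volume.\<close>

lemma nn_integral_bounded_range:
  fixes U :: "'a::euclidean_space \<Rightarrow> real"
  assumes [measurable]: "U \<in> borel_measurable borel"
    and U: "\<And>x. 0 \<le> U x" and fin: "(\<integral>\<^sup>+x. ennreal (G (U x)) \<partial>lborel) < \<infinity>"
  shows "(\<integral>\<^sup>+p. ennreal (G (U (fst p)) + G (U (snd p))) * indicator {..<R} (norm (fst p - snd p))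
      \<partial>(lborel :: ('a \<times> 'a) measure)) < \<infinity>"
proof -
  define k where "k x r = ennreal (G (U x)) * indicator {..<R} r" for x r
  have k [measurable]: "case_prod k \<in> borel_measurable borel"
    unfolding k_def borel_prod[symmetric] by measurable
  have k' [measurable]: "case_prod k \<in> borel_measurable (borel \<Otimes>\<^sub>M borel)"
    using k by (simp add: borel_prod)
  have [measurable]: "(\<lambda>p. k (fst p) (norm (fst p - snd p))) \<in> borel_measurable borel"
    "(\<lambda>p. k (snd p) (norm (fst p - snd p))) \<in> borel_measurable borel"
    unfolding k_def borel_prod[symmetric] by measurable
  have ball: "(\<integral>\<^sup>+h. indicator {..<R} (norm h) \<partial>(lborel :: 'a measure)) = emeasure lborel (ball (0::'a) R)"
  proof -
    have "(\<integral>\<^sup>+h. indicator {..<R} (norm h) \<partial>(lborel :: 'a measure)) = (\<integral>\<^sup>+h. indicator (ball 0 R) h \<partial>(lborel :: 'a measure))"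
      by (intro nn_integral_cong) (simp add: indicator_def)
    then show ?thesis
      by simp
  qed
  have "(\<integral>\<^sup>+h. k x (norm h) \<partial>(lborel :: 'a measure)) = ennreal (G (U x)) * emeasure lborel (ball (0::'a) R)" for x
    unfolding k_def by (subst nn_integral_cmult) (simp_all add: ball)
  then have "(\<integral>\<^sup>+x. \<integral>\<^sup>+h. k x (norm (h::'a)) \<partial>lborel \<partial>lborel) =
      (\<integral>\<^sup>+x. ennreal (G (U x)) \<partial>lborel) * emeasure lborel (ball (0::'a) R)"
    by (simp add: nn_integral_multc)
  also have "\<dots> < \<infinity>"
    using fin emeasure_bounded_finite[OF bounded_ball, of "0::'a" R] by (simp add: ennreal_mult_less_top)
  finally have I: "(\<integral>\<^sup>+x. \<integral>\<^sup>+h. k x (norm (h::'a)) \<partial>lborel \<partial>lborel) < \<infinity>" .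
  have "(\<integral>\<^sup>+p. ennreal (G (U (fst p)) + G (U (snd p))) * indicator {..<R} (norm (fst p - snd p))
      \<partial>(lborel :: ('a \<times> 'a) measure)) =
      (\<integral>\<^sup>+p. k (fst p) (norm (fst p - snd p)) + k (snd p) (norm (fst p - snd p)) \<partial>lborel)"
    by (intro nn_integral_cong) (use U nonneg in \<open>simp add: k_def distrib_right\<close>)
  also have "\<dots> = (\<integral>\<^sup>+p. k (fst p) (norm (fst p - snd p)) \<partial>lborel) +
      (\<integral>\<^sup>+p. k (snd p) (norm (fst p - snd p)) \<partial>lborel)"
    by (intro nn_integral_add) simp_all
  also have "\<dots> < \<infinity>"
    using nn_integral_pair_norm_diff[OF k] I by simp
  finally show ?thesis .
qed

text \<open>The flags \<open>i\<close> and \<open>j\<close> mark endpoints in the tail, and the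
  error may contain only flagged terms. Almost subadditivity is therefore used with the flagged
  argument in the second slot. In the lower bound the flagged term itself also goes into the error,
  whence \<open>K + 1\<close>.\<close>

lemma almost_additive_of_small_argument:
  assumes K: "0 \<le> K" "\<forall>a\<ge>0. \<forall>b\<ge>0. (1 - \<eta>) * G (a + b) \<le> G a + K * G b"
    and \<eta>: "0 < \<eta>" "\<eta> < 1"
    and ab: "0 \<le> a" "0 \<le> b" and w: "0 \<le> w" "w \<le> a + b" "a \<le> w + b" "b \<le> w + a"
    and ij: "0 \<le> i" "0 \<le> j" "i = 1 \<or> j = 1"
  shows "(1 - \<eta>) * G w \<le> G a + G b + K * (G a * i + G b * j)" (is ?upper)
    and "(1 - \<eta>) * (G a + G b) \<le> G w + (K + 1) * (G a * i + G b * j)" (is ?lower)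
proof -
  have sub: "(1 - \<eta>) * G z \<le> G x + K * G y" if "0 \<le> x" "0 \<le> y" "z \<le> x + y" for x y z
  proof -
    have "(1 - \<eta>) * G z \<le> (1 - \<eta>) * G (x + y)"
      using \<eta> by (intro mult_left_mono monoD[OF mono that(3)]) simp
    also have "\<dots> \<le> G x + K * G y"
      using K(2) that by blast
    finally show ?thesis .
  qed
  have nn: "0 \<le> G a" "0 \<le> G b" "0 \<le> G w" "0 \<le> K * (G a * i)" "0 \<le> K * (G b * j)" "0 \<le> G a * i" "0 \<le> G b * j"
    using ab w(1) ij K(1) nonneg by auto
  have small: "(1 - \<eta>) * G a \<le> G a" "(1 - \<eta>) * G b \<le> G b"
    using nn \<eta> by (simp_all add: mult_left_le_one_le)
  show ?upper
    using ij(3)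
  proof
    assume "i = 1"
    then show ?thesis
      using sub[of b a w] ab w nn by (simp add: distrib_left)
  next
    assume "j = 1"
    then show ?thesis
      using sub[of a b w] ab w nn by (simp add: distrib_left)
  qed
  show ?lower
    using ij(3)
  proof
    assume "i = 1"
    then show ?thesis
      using sub[of w a b] small ab w nn by (simp add: distrib_left distrib_right)
  next
    assume "j = 1"
    then show ?thesis
      using sub[of w b a] small ab w nn by (simp add: distrib_left distrib_right)
  qed
qed

text \<open>The magnetic structure enters only through three triangle inequalities between
  \<open>W\<close> and the endpoint values of \<open>U\<close>. Finiteness of \<open>E\<close> at
  \<open>s0\<close> controls the singularity on the diagonal for all smaller orders.\<close>

lemma small_order_limit:
  fixes U :: "'a::euclidean_space \<Rightarrow> real" and W :: "'a \<times> 'a \<Rightarrow> real"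
  assumes [measurable]: "U \<in> borel_measurable borel" "W \<in> borel_measurable borel"
    and U: "\<And>x. 0 \<le> U x"
    and W: "\<And>p. W p \<le> U (fst p) + U (snd p)" "\<And>p. U (fst p) \<le> W p + U (snd p)"
      "\<And>p. U (snd p) \<le> W p + U (fst p)"
    and fin: "(\<integral>\<^sup>+x. ennreal (G (U x)) \<partial>lborel) < \<infinity>"
    and Gbar_le: "\<And>t. 0 \<le> t \<Longrightarrow> Gbar t \<le> ennreal (G t)"
  defines "E \<equiv> \<lambda>s. \<integral>\<^sup>+p. ennreal (G (W p / norm (fst p - snd p) powr s) / norm (fst p - snd p) ^ DIM('a)) \<partial>lborel"
  assumes s0: "0 < s0" and E0: "E s0 < \<infinity>"
  shows "((\<lambda>s. ennreal s * E s) \<longlongrightarrow>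
      ennreal (2 * radial_const TYPE('a)) * (\<integral>\<^sup>+x. Gbar (U x) \<partial>lborel)) (at_right 0)"
proof -
  define \<rho> where "\<rho> = radial_const TYPE('a)"
  have \<rho>: "0 \<le> \<rho>"
    by (simp add: \<rho>_def radial_const_def)
  define h where "h p = norm (fst p - snd p)" for p :: "'a \<times> 'a"
  define q where "q s p = G (W p / h p powr s) / h p ^ DIM('a)" for s p
  \<comment> \<open>Here \<alpha> and \<beta> are the separate contributions of the two endpoints at
    distance at least 1, whose integrals are known exactly; \<theta> dominates what happens at
    bounded distance, uniformly in \<open>s\<close>.\<close>
  define \<alpha> where "\<alpha> S s p = G (U (fst p) / h p powr s) / h p ^ DIM('a) * indicator {1..} (h p) * indicator S (fst p)"
    for S s p
  define \<beta> where "\<beta> S s p = G (U (snd p) / h p powr s) / h p ^ DIM('a) * indicator {1..} (h p) * indicator S (snd p)"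
    for S s p
  define \<theta> where "\<theta> R p = (G (U (fst p)) + G (U (snd p))) * indicator {..<R} (h p)" for R p
  define T where "T S = (\<integral>\<^sup>+x. Gbar (U x) * indicator S x \<partial>lborel)" for S :: "'a set"
  have W0: "0 \<le> W p" for p
    using W(2,3)[of p] by simp
  have h0: "0 \<le> h p" for p
    by (simp add: h_def)
  have hm [measurable]: "h \<in> borel_measurable borel"
    unfolding h_def[abs_def] borel_prod[symmetric] by measurable
  have fm [measurable]: "fst \<in> borel_measurable (borel :: ('a \<times> 'a) measure)" "snd \<in> borel_measurable (borel :: ('a \<times> 'a) measure)"
    by (simp_all add: borel_prod[symmetric])
  have [measurable]: "q s \<in> borel_measurable borel" "\<theta> R \<in> borel_measurable borel" for s R
    unfolding q_def \<theta>_def by measurable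
  have abm [measurable]: "\<alpha> S s \<in> borel_measurable borel" "\<beta> S s \<in> borel_measurable borel" if [measurable]: "S \<in> sets borel" for S s
    unfolding \<alpha>_def \<beta>_def by measurable
  have nn: "0 \<le> q s p" "0 \<le> \<alpha> S s p" "0 \<le> \<beta> S s p" "0 \<le> \<theta> R p" for s S R p
    using U W0 h0 nonneg by (auto simp: q_def \<alpha>_def \<beta>_def \<theta>_def)

  have Eq: "E s = (\<integral>\<^sup>+p. ennreal (q s p) \<partial>lborel)" for s
    by (simp add: E_def q_def h_def)
  have I\<alpha>: "(\<integral>\<^sup>+p. ennreal (\<alpha> S s p) \<partial>lborel) = ennreal (\<rho> / s) * T S"
    if S: "S \<in> sets borel" and s: "0 < s" for S s
    unfolding T_def \<rho>_def nn_integral_far_field(1)[OF assms(1) S U s, symmetric] \<alpha>_def h_def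
    by (intro nn_integral_cong) (simp add: indicator_def)
  have I\<beta>: "(\<integral>\<^sup>+p. ennreal (\<beta> S s p) \<partial>lborel) = ennreal (\<rho> / s) * T S"
    if S: "S \<in> sets borel" and s: "0 < s" for S s
    unfolding T_def \<rho>_def nn_integral_far_field(2)[OF assms(1) S U s, symmetric] \<beta>_def h_def
    by (intro nn_integral_cong) (simp add: indicator_def)
  have I\<theta>: "(\<integral>\<^sup>+p. ennreal (\<theta> R p) \<partial>lborel) < \<infinity>" for R
  proof -
    have "(\<integral>\<^sup>+p. ennreal (\<theta> R p) \<partial>lborel) =
        (\<integral>\<^sup>+p. ennreal (G (U (fst p)) + G (U (snd p))) * indicator {..<R} (norm (fst p - snd p)) \<partial>lborel)"
      by (intro nn_integral_cong) (simp add: \<theta>_def h_def indicator_def)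
    then show ?thesis
      using nn_integral_bounded_range[OF assms(1) U fin, of R] by simp
  qed
  have Tfin: "T UNIV < \<infinity>"
  proof -
    have "T UNIV \<le> (\<integral>\<^sup>+x. ennreal (G (U x)) \<partial>lborel)"
      unfolding T_def using Gbar_le U by (intro nn_integral_mono) simp
    then show ?thesis
      using fin by (rule order.strict_trans1)
  qed
  have TS: "T S \<le> T UNIV" for S
    unfolding T_def by (intro nn_integral_mono) (simp add: indicator_def)
  define b where "b = enn2real (T UNIV)"
  have b: "T UNIV = ennreal b" "0 \<le> b"
    using Tfin by (simp_all add: b_def)

  \<comment> \<open>One inequality in each direction has to hold for all pairs, so the nonnegative
    errors of the three distance ranges are simply added: \<open>q s0\<close> for the near range,
    \<theta> for the middle one, and the terms restricted to \<open>S\<close> for the far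
    one.\<close>
  have pointwise:
    "(1 - \<eta>) * q s p \<le> \<alpha> UNIV s p + \<beta> UNIV s p + K * (\<alpha> S s p + \<beta> S s p) + (1 + K) * \<theta> (2 * M) p + q s0 p"
    "(1 - \<eta>) * (\<alpha> UNIV s p + \<beta> UNIV s p) \<le> q s p + (K + 1) * (\<alpha> S s p + \<beta> S s p) + \<theta> (2 * M) p"
    if K: "0 \<le> K" "\<forall>a\<ge>0. \<forall>b\<ge>0. (1 - \<eta>) * G (a + b) \<le> G a + K * G b"
      and \<eta>: "0 < \<eta>" "\<eta> < 1" and s: "0 < s" "s \<le> s0" and M: "1 \<le> M" and S: "S = {x. M \<le> norm x}"
    for \<eta> K s M S p
  proof -
    define a b w d where "a = U (fst p) / h p powr s" and "b = U (snd p) / h p powr s"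
      and "w = W p / h p powr s" and "d = h p ^ DIM('a)"
    have abw: "0 \<le> a" "0 \<le> b" "0 \<le> w" "0 \<le> d" "0 \<le> G a" "0 \<le> G b" "0 \<le> G w"
      using U W0 h0 nonneg by (simp_all add: a_def b_def w_def d_def)
    have tri: "w \<le> a + b" "a \<le> w + b" "b \<le> w + a"
      unfolding a_def b_def w_def add_divide_distrib[symmetric]
      using W[of p] by (auto intro!: divide_right_mono)
    consider (near) "h p < 1" | (middle) "1 \<le> h p" "h p < 2 * M" | (far) "1 \<le> h p" "2 * M \<le> h p"
      by linarith
    note h_cases = this
    have ab_near: "\<alpha> S s p = 0" "\<beta> S s p = 0" if "h p < 1" for S
      using that by (simp_all add: \<alpha>_def \<beta>_def)
    have ab_far: "\<alpha> S s p = G a / d * indicator S (fst p)" "\<beta> S s p = G b / d * indicator S (snd p)" if "1 \<le> h p" for S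
      using that by (simp_all add: \<alpha>_def \<beta>_def a_def b_def d_def)
    have qd: "q s p = G w / d"
      by (simp add: q_def w_def d_def)
    have nnK: "0 \<le> K * (\<alpha> S s p + \<beta> S s p)" "0 \<le> (1 + K) * \<theta> (2 * M) p"
      using nn K(1) by simp_all
    \<comment> \<open>For distances below 1, \<open>h p powr s\<close> decreases in
      \<open>s\<close>, so the integrand grows with the order. On the diagonal both sides are 0 by
      the convention on division.\<close>
    have q0: "q s p \<le> q s0 p" if "h p < 1"
    proof (cases "h p = 0")
      case False
      then have h: "0 < h p"
        using h0[of p] by simp
      have "h p powr s0 \<le> h p powr s"
        using h that s by (intro powr_mono') auto
      then have "W p / h p powr s \<le> W p / h p powr s0"
        using W0 h by (intro divide_left_mono) auto
      then show ?thesis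
        unfolding q_def using h by (intro divide_right_mono monoD[OF mono]) auto
    qed (simp add: q_def)
    \<comment> \<open>At distance at least 1 both denominators are at least 1, so dropping them only
      increases the terms.\<close>
    have mid: "G a / d + G b / d \<le> \<theta> (2 * M) p" if "1 \<le> h p" "h p < 2 * M"
    proof -
      have "1 \<le> h p powr s" "1 \<le> d"
        using that s by (auto simp: d_def ge_one_powr_ge_zero)
      have shrink: "G (U x / h p powr s) / d \<le> G (U x)" for x
      proof -
        have "U x / h p powr s \<le> U x / 1"
          using \<open>1 \<le> h p powr s\<close> U by (intro divide_left_mono) auto
        then have "G (U x / h p powr s) \<le> G (U x)"
          by (intro monoD[OF mono]) simp
        moreover have "G (U x / h p powr s) / d \<le> G (U x / h p powr s) / 1"
          using \<open>1 \<le> d\<close> U nonneg by (intro divide_left_mono) auto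
        ultimately show ?thesis
          by simp
      qed
      show ?thesis
        using add_mono[OF shrink[of "fst p"] shrink[of "snd p"]] that by (simp add: a_def b_def \<theta>_def)
    qed
    \<comment> \<open>Two points at distance at least \<open>2 * M\<close> cannot both have norm
      below \<open>M\<close>.\<close>
    have flags: "(indicator S (fst p) :: real) = 1 \<or> (indicator S (snd p) :: real) = 1" if "2 * M \<le> h p"
    proof -
      have "h p \<le> norm (fst p) + norm (snd p)"
        unfolding h_def by (rule norm_triangle_ineq4)
      with that show ?thesis
        by (auto simp: S indicator_def)
    qed
    note tail = almost_additive_of_small_argument[OF K \<eta> abw(1,2,3) tri indicator_pos_le indicator_pos_le flags]
    show "(1 - \<eta>) * q s p \<le> \<alpha> UNIV s p + \<beta> UNIV s p + K * (\<alpha> S s p + \<beta> S s p) + (1 + K) * \<theta> (2 * M) p + q s0 p"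
      using h_cases
    proof cases
      case near
      have "(1 - \<eta>) * q s p \<le> 1 * q s p"
        using \<eta> nn by (intro mult_right_mono) auto
      then show ?thesis
        using q0[OF near] nn(2,3)[of UNIV s p] nnK by simp
    next
      case middle
      have "(1 - \<eta>) * G w \<le> (1 - \<eta>) * G (a + b)"
        using tri \<eta> by (intro mult_left_mono monoD[OF mono]) auto
      also have "\<dots> \<le> G a + K * G b"
        using K abw by blast
      also have "\<dots> \<le> (1 + K) * (G a + G b)"
        using K(1) abw by (simp add: algebra_simps)
      finally have "(1 - \<eta>) * G w / d \<le> (1 + K) * (G a + G b) / d"
        using abw by (intro divide_right_mono)
      also have "\<dots> = (1 + K) * (G a / d + G b / d)"
        by (simp only: add_divide_distrib[symmetric] times_divide_eq_right)
      also have "\<dots> \<le> (1 + K) * \<theta> (2 * M) p"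
        using K(1) mid[OF middle] by (intro mult_left_mono) auto
      finally show ?thesis
        using nnK(1) nn(1)[of s0 p] nn(2,3)[of UNIV s p] by (simp add: qd)
    next
      case far
      have "(1 - \<eta>) * G w / d \<le> (G a + G b + K * (G a * indicator S (fst p) + G b * indicator S (snd p))) / d"
        using \<open>2 * M \<le> h p\<close> abw by (intro divide_right_mono tail(1)) auto
      also have "\<dots> = \<alpha> UNIV s p + \<beta> UNIV s p + K * (\<alpha> S s p + \<beta> S s p)"
        by (simp add: ab_far[OF far(1)] add_divide_distrib distrib_left)
      finally show ?thesis
        using nnK(2) nn(1)[of s0 p] by (simp add: qd)
    qed
    show "(1 - \<eta>) * (\<alpha> UNIV s p + \<beta> UNIV s p) \<le> q s p + (K + 1) * (\<alpha> S s p + \<beta> S s p) + \<theta> (2 * M) p"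
      using h_cases
    proof cases
      case near
      then show ?thesis
        using nn(1)[of s p] nn(4)[of "2 * M" p] by (simp add: ab_near)
    next
      case middle
      have "(1 - \<eta>) * (\<alpha> UNIV s p + \<beta> UNIV s p) \<le> 1 * (\<alpha> UNIV s p + \<beta> UNIV s p)"
        using \<eta> nn by (intro mult_right_mono add_nonneg_nonneg) auto
      moreover have "0 \<le> (K + 1) * (\<alpha> S s p + \<beta> S s p)"
        using K(1) nn by simp
      ultimately show ?thesis
        using mid[OF middle] nn(1)[of s p] by (simp add: ab_far[OF middle(1)])
    next
      case far
      have "(1 - \<eta>) * (G a + G b) / d \<le> (G w + (K + 1) * (G a * indicator S (fst p) + G b * indicator S (snd p))) / d"
        using \<open>2 * M \<le> h p\<close> abw by (intro divide_right_mono tail(2)) auto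
      also have "\<dots> = q s p + (K + 1) * (\<alpha> S s p + \<beta> S s p)"
        by (simp add: qd ab_far[OF far(1)] add_divide_distrib distrib_left)
      also have "(1 - \<eta>) * (G a + G b) / d = (1 - \<eta>) * (\<alpha> UNIV s p + \<beta> UNIV s p)"
        by (simp add: ab_far[OF far(1)] add_divide_distrib distrib_left)
      finally show ?thesis
        using nn(4)[of "2 * M" p] by simp
    qed
  qed

  \<comment> \<open>Integration produces \<open>\<rho> / s\<close> in front of the exact terms;
    multiplying by \<open>s\<close> removes it. The constants \<open>c\<close> and \<open>e0\<close>
    do not depend on \<open>s\<close>, so their contribution vanishes as \<open>s\<close> tends to
    0, and only the tail \<open>t\<close> remains to be made small.\<close>
  have integrated:
    "E s < \<infinity>"
    "(1 - \<eta>) * (s * enn2real (E s)) \<le> 2 * \<rho> * b + K * (2 * \<rho> * t) + s * ((1 + K) * c + e0)"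
    "(1 - \<eta>) * (2 * \<rho> * b) \<le> s * enn2real (E s) + (K + 1) * (2 * \<rho> * t) + s * c"
    if K: "0 \<le> K" "\<forall>a\<ge>0. \<forall>b\<ge>0. (1 - \<eta>) * G (a + b) \<le> G a + K * G b"
      and \<eta>: "0 < \<eta>" "\<eta> < 1" and s: "0 < s" "s \<le> s0" and M: "1 \<le> M" and S: "S = {x. M \<le> norm x}"
      and t: "T S = ennreal t" "0 \<le> t" and c: "(\<integral>\<^sup>+p. ennreal (\<theta> (2 * M) p) \<partial>lborel) = ennreal c" "0 \<le> c"
      and e0: "E s0 = ennreal e0" "0 \<le> e0"
    for \<eta> K s M S t c e0
  proof -
    have \<eta>': "0 \<le> 1 - \<eta>"
      using \<eta> by simp
    define r where "r = \<rho> / s"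
    have r: "0 \<le> r" "s * r = \<rho>"
      using \<rho> s by (simp_all add: r_def)
    note pw = pointwise[OF K \<eta> s M S]
    have [measurable]: "S \<in> sets borel"
      unfolding S by measurable
    have "ennreal (1 - \<eta>) * E s = (\<integral>\<^sup>+p. ennreal ((1 - \<eta>) * q s p) \<partial>lborel)"
      unfolding Eq using \<eta> nn by (simp add: nn_integral_cmult ennreal_mult)
    also have "\<dots> \<le> (\<integral>\<^sup>+p. ennreal (\<alpha> UNIV s p + \<beta> UNIV s p + K * (\<alpha> S s p + \<beta> S s p) + (1 + K) * \<theta> (2 * M) p + q s0 p) \<partial>lborel)"
      by (intro nn_integral_mono ennreal_leI pw(1))
    also have "\<dots> = (\<integral>\<^sup>+p. ennreal (\<alpha> UNIV s p) + ennreal (\<beta> UNIV s p) + ennreal K * (ennreal (\<alpha> S s p) + ennreal (\<beta> S s p)) +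
        ennreal (1 + K) * ennreal (\<theta> (2 * M) p) + ennreal (q s0 p) \<partial>lborel)"
      using nn K(1) by (intro nn_integral_cong) (simp add: ennreal_mult)
    also have "\<dots> = ennreal r * T UNIV + ennreal r * T UNIV +
        ennreal K * (ennreal r * T S + ennreal r * T S) + ennreal (1 + K) * ennreal c + E s0"
      using s by (simp add: nn_integral_add nn_integral_cmult I\<alpha> I\<beta> r_def c(1) Eq)
    also have "\<dots> = ennreal (2 * r * b + K * (2 * r * t) + (1 + K) * c + e0)"
    \<comment> \<open>Each factor 2 is split into the equal contributions of \<alpha> and \<beta>;
      all summands are nonnegative, so the embedding into \<open>ennreal\<close> respects the sums
      and products.\<close>
    proof -
      have "2 * r * b + K * (2 * r * t) + (1 + K) * c + e0 =
          r * b + r * b + K * (r * t + r * t) + (1 + K) * c + e0"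
        by simp
      also have "ennreal \<dots> = ennreal r * T UNIV + ennreal r * T UNIV +
          ennreal K * (ennreal r * T S + ennreal r * T S) + ennreal (1 + K) * ennreal c + E s0"
        unfolding b(1) t(1) e0(1) using r(1) K(1) t(2) c(2) e0(2) b(2)
        by (simp only: ennreal_mult ennreal_plus add_nonneg_nonneg mult_nonneg_nonneg zero_le_one)
      finally show ?thesis ..
    qed
    finally have up: "ennreal (1 - \<eta>) * E s \<le> ennreal (2 * r * b + K * (2 * r * t) + (1 + K) * c + e0)" .
    then have "ennreal (1 - \<eta>) * E s < \<infinity>"
      by (rule order.strict_trans1) simp
    then show fin: "E s < \<infinity>"
      using \<eta> by (auto simp: ennreal_mult_less_top)
    then obtain e where e: "E s = ennreal e" "0 \<le> e"
      by (cases "E s") auto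
    have "(1 - \<eta>) * e \<le> 2 * r * b + K * (2 * r * t) + (1 + K) * c + e0"
    proof -
      have "0 \<le> 2 * r * b + K * (2 * r * t) + (1 + K) * c + e0"
        using r(1) K(1) t(2) c(2) e0(2) b(2) by simp
      moreover have "ennreal ((1 - \<eta>) * e) \<le> ennreal (2 * r * b + K * (2 * r * t) + (1 + K) * c + e0)"
        using up e \<eta> by (simp add: ennreal_mult)
      ultimately show ?thesis
        by (simp only: ennreal_le_iff)
    qed
    then have "s * ((1 - \<eta>) * e) \<le> s * (2 * r * b + K * (2 * r * t) + (1 + K) * c + e0)"
      using s by (intro mult_left_mono) auto
    also have "\<dots> = 2 * \<rho> * b + K * (2 * \<rho> * t) + s * ((1 + K) * c + e0)"
      by (simp add: r(2)[symmetric] algebra_simps)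
    finally show "(1 - \<eta>) * (s * enn2real (E s)) \<le> 2 * \<rho> * b + K * (2 * \<rho> * t) + s * ((1 + K) * c + e0)"
      using e by (simp add: mult.left_commute)

    have "ennreal (1 - \<eta>) * (ennreal r * T UNIV + ennreal r * T UNIV) =
        (\<integral>\<^sup>+p. ennreal (1 - \<eta>) * (ennreal (\<alpha> UNIV s p) + ennreal (\<beta> UNIV s p)) \<partial>lborel)"
      using s by (simp add: nn_integral_add nn_integral_cmult I\<alpha> I\<beta> r_def)
    also have "\<dots> = (\<integral>\<^sup>+p. ennreal ((1 - \<eta>) * (\<alpha> UNIV s p + \<beta> UNIV s p)) \<partial>lborel)"
      using nn \<eta> by (intro nn_integral_cong) (simp add: ennreal_mult)
    also have "\<dots> \<le> (\<integral>\<^sup>+p. ennreal (q s p + (K + 1) * (\<alpha> S s p + \<beta> S s p) + \<theta> (2 * M) p) \<partial>lborel)"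
      by (intro nn_integral_mono ennreal_leI pw(2))
    also have "\<dots> = (\<integral>\<^sup>+p. ennreal (q s p) + ennreal (K + 1) * (ennreal (\<alpha> S s p) + ennreal (\<beta> S s p)) +
        ennreal (\<theta> (2 * M) p) \<partial>lborel)"
      using nn K(1) by (intro nn_integral_cong) (simp add: ennreal_mult)
    also have "\<dots> = E s + ennreal (K + 1) * (ennreal r * T S + ennreal r * T S) + ennreal c"
      using s by (simp add: nn_integral_add nn_integral_cmult I\<alpha> I\<beta> r_def c(1) Eq)
    also have "\<dots> = ennreal (e + (K + 1) * (2 * r * t) + c)"
    proof -
      have "e + (K + 1) * (2 * r * t) + c = e + (K + 1) * (r * t + r * t) + c"
        by simp
      also have "ennreal \<dots> = E s + ennreal (K + 1) * (ennreal r * T S + ennreal r * T S) + ennreal c"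
        unfolding e(1) t(1) using r(1) K(1) t(2) c(2) e(2)
        by (simp only: ennreal_mult ennreal_plus add_nonneg_nonneg mult_nonneg_nonneg zero_le_one)
      finally show ?thesis ..
    qed
    also have "ennreal (1 - \<eta>) * (ennreal r * T UNIV + ennreal r * T UNIV) =
        ennreal ((1 - \<eta>) * (2 * r * b))"
    proof -
      have "(1 - \<eta>) * (2 * r * b) = (1 - \<eta>) * (r * b + r * b)"
        by simp
      also have "ennreal \<dots> = ennreal (1 - \<eta>) * (ennreal r * T UNIV + ennreal r * T UNIV)"
        unfolding b(1) using r(1) b(2) \<eta>'
        by (simp only: ennreal_mult ennreal_plus add_nonneg_nonneg mult_nonneg_nonneg)
      finally show ?thesis ..
    qed
    finally have "(1 - \<eta>) * (2 * r * b) \<le> e + (K + 1) * (2 * r * t) + c"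
    proof -
      assume "ennreal ((1 - \<eta>) * (2 * r * b)) \<le> ennreal (e + (K + 1) * (2 * r * t) + c)"
      moreover have "0 \<le> e + (K + 1) * (2 * r * t) + c"
        using r(1) K(1) t(2) c(2) e(2) by simp
      ultimately show ?thesis
        by (simp only: ennreal_le_iff)
    qed
    then have "s * ((1 - \<eta>) * (2 * r * b)) \<le> s * (e + (K + 1) * (2 * r * t) + c)"
      using s by (intro mult_left_mono) auto
    also have "s * ((1 - \<eta>) * (2 * r * b)) = (1 - \<eta>) * (2 * \<rho> * b)"
      by (simp add: r(2)[symmetric])
    also have "s * (e + (K + 1) * (2 * r * t) + c) = s * e + (K + 1) * (2 * \<rho> * t) + s * c"
      by (simp add: r(2)[symmetric] algebra_simps)
    finally show "(1 - \<eta>) * (2 * \<rho> * b) \<le> s * enn2real (E s) + (K + 1) * (2 * \<rho> * t) + s * c"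
      using e by simp
  qed

  obtain e0 where e0: "E s0 = ennreal e0" "0 \<le> e0"
    using E0 by (cases "E s0") auto
  have ev_s: "\<forall>\<^sub>F s in at_right 0. 0 < s \<and> s \<le> s0"
    using eventually_at_right_less[of 0] eventually_at_right[OF s0] s0
    by (auto simp: eventually_at_right_field intro: exI[of _ s0])
  have "((\<lambda>s. s * enn2real (E s)) \<longlongrightarrow> 2 * \<rho> * b) (at_right 0)"
  proof (rule tendsto_of_almost_bounds)
    show "0 \<le> 2 * \<rho> * b"
      using \<rho> b by simp
  next
    fix \<eta> \<epsilon> :: real
    assume \<eta>: "0 < \<eta>" "\<eta> < 1" and \<epsilon>: "0 < \<epsilon>"
    obtain K where K: "0 \<le> K" "\<forall>a\<ge>0. \<forall>b\<ge>0. (1 - \<eta>) * G (a + b) \<le> G a + K * G b"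
      by (rule almost_subadditive[OF \<eta>])
    \<comment> \<open>A tail mass below this value costs at most \<open>\<epsilon> / 2\<close> after
      multiplication by \<open>(K + 1) * (2 * \<rho>)\<close>. The radius is thus chosen after
      \<open>K\<close>, and the range of \<open>s\<close> only after the radius.\<close>
    define \<delta> where "\<delta> = \<epsilon> / 2 / (K + 1) / (2 * \<rho> + 1)"
    have \<delta>: "0 < \<delta>"
      using \<epsilon> K(1) \<rho> by (simp add: \<delta>_def)
    have "(\<lambda>N. T {x. real N \<le> norm x}) \<longlonglongrightarrow> 0"
      unfolding T_def using Tfin by (intro nn_integral_tail_tendsto_0) (simp_all add: T_def)
    then have "\<forall>\<^sub>F N in sequentially. T {x. real N \<le> norm x} < ennreal \<delta>"
      using \<delta> by (intro order_tendstoD(2)) auto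
    then have "\<forall>\<^sub>F N in sequentially. T {x. real N \<le> norm x} < ennreal \<delta> \<and> 1 \<le> N"
      using eventually_ge_at_top by (rule eventually_conj)
    then obtain N where N: "T {x. real N \<le> norm x} < ennreal \<delta>" "1 \<le> N"
      by (auto dest: eventually_happens)
    define M where "M = real N"
    define S where "S = {x :: 'a. M \<le> norm x}"
    have M: "1 \<le> M"
      using N by (simp add: M_def)
    obtain t where t: "T S = ennreal t" "0 \<le> t"
      using N(1) by (cases "T S") (auto simp: S_def M_def)
    have "t < \<delta>"
      using N(1) t by (simp add: S_def M_def ennreal_less_iff)
    obtain c where c: "(\<integral>\<^sup>+p. ennreal (\<theta> (2 * M) p) \<partial>lborel) = ennreal c" "0 \<le> c"
      using I\<theta>[of "2 * M"] by (cases "\<integral>\<^sup>+p. ennreal (\<theta> (2 * M) p) \<partial>lborel") auto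
    have "(K + 1) * (2 * \<rho> * t) \<le> (K + 1) * ((2 * \<rho> + 1) * \<delta>)"
      using K(1) \<rho> t \<open>t < \<delta>\<close> by (intro mult_left_mono mult_mono) auto
    also have "\<dots> = \<epsilon> / 2"
    proof -
      have "K + 1 \<noteq> 0" "2 * \<rho> + 1 \<noteq> 0"
        using K(1) \<rho> by linarith+
      then show ?thesis
        unfolding \<delta>_def by (metis nonzero_mult_div_cancel_left times_divide_eq_right)
    qed
    finally have tail: "(K + 1) * (2 * \<rho> * t) \<le> \<epsilon> / 2" .
    moreover have "K * (2 * \<rho> * t) \<le> (K + 1) * (2 * \<rho> * t)"
      using \<rho> t by (intro mult_right_mono) auto
    ultimately have tail': "K * (2 * \<rho> * t) \<le> \<epsilon> / 2"
      by simp
    have "((\<lambda>s. s * ((1 + K) * c + e0)) \<longlongrightarrow> 0 * ((1 + K) * c + e0)) (at_right 0)"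
      by (intro tendsto_intros)
    then have ev_c: "\<forall>\<^sub>F s in at_right 0. s * ((1 + K) * c + e0) < \<epsilon> / 2"
      using \<epsilon> by (intro order_tendstoD(2)) auto
    show "\<forall>\<^sub>F s in at_right 0. (1 - \<eta>) * (s * enn2real (E s)) \<le> 2 * \<rho> * b + \<epsilon> \<and>
        (1 - \<eta>) * (2 * \<rho> * b) \<le> s * enn2real (E s) + \<epsilon>"
      using ev_s ev_c
    proof eventually_elim
      fix s
      assume s: "0 < s \<and> s \<le> s0" and small: "s * ((1 + K) * c + e0) < \<epsilon> / 2"
      note bounds = integrated[OF K \<eta> s[THEN conjunct1] s[THEN conjunct2] M S_def t c e0]
      have "s * c \<le> s * ((1 + K) * c + e0)"
        using s K(1) c e0 by (intro mult_left_mono) (auto simp: algebra_simps)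
      with bounds(2,3) small tail tail'
      show "(1 - \<eta>) * (s * enn2real (E s)) \<le> 2 * \<rho> * b + \<epsilon> \<and>
          (1 - \<eta>) * (2 * \<rho> * b) \<le> s * enn2real (E s) + \<epsilon>"
        by argo
    qed
  qed
  then have "((\<lambda>s. ennreal (s * enn2real (E s))) \<longlongrightarrow> ennreal (2 * \<rho> * b)) (at_right 0)"
    by (rule tendsto_ennrealI)
  moreover have "ennreal (2 * \<rho> * b) = ennreal (2 * \<rho>) * (\<integral>\<^sup>+x. Gbar (U x) \<partial>lborel)"
    using b \<rho> by (simp add: T_def ennreal_mult)
  \<comment> \<open>The real-valued limit transfers back only where \<open>E s\<close> is finite,
    since \<open>enn2real\<close> sends infinity to 0. Any admissible parameters show this; one half
    for \<eta> and 1 for \<open>M\<close> will do.\<close>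
  moreover have "\<forall>\<^sub>F s in at_right 0. ennreal (s * enn2real (E s)) = ennreal s * E s"
  proof -
    obtain K where K: "0 \<le> K" "\<forall>a\<ge>0. \<forall>b\<ge>0. (1 - 1/2) * G (a + b) \<le> G a + K * G b"
      by (rule almost_subadditive[of "1/2"]) auto
    obtain t where t: "T {x. 1 \<le> norm x} = ennreal t" "0 \<le> t"
      using TS[of "{x. 1 \<le> norm x}"] Tfin by (cases "T {x. 1 \<le> norm x}") (auto simp: top_unique)
    obtain c where c: "(\<integral>\<^sup>+p. ennreal (\<theta> (2 * 1) p) \<partial>lborel) = ennreal c" "0 \<le> c"
      using I\<theta>[of "2 * 1"] by (cases "\<integral>\<^sup>+p. ennreal (\<theta> (2 * 1) p) \<partial>lborel") auto
    show ?thesis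
      using ev_s
    proof eventually_elim
      fix s assume s: "0 < s \<and> s \<le> s0"
      have "E s < \<infinity>"
        using integrated(1)[OF K _ _ s[THEN conjunct1] s[THEN conjunct2] _ refl t c e0] by simp
      then show "ennreal (s * enn2real (E s)) = ennreal s * E s"
        using s by (simp add: ennreal_mult)
    qed
  qed
  ultimately show ?thesis
    unfolding \<rho>_def[symmetric] using tendsto_cong by fastforce
qed
end

section \<open>The magnetic modular\<close>

text \<open>Identifies the surface measure of the sphere as the dimension times the volume of the
  unit ball.\<close>

lemma cone_over_unit_sphere:
  "{r *\<^sub>R x | r x. 0 \<le> r \<and> r \<le> 1 \<and> x \<in> sphere (0 :: 'a::euclidean_space) 1} = cball 0 1"
proof (intro set_eqI iffI)
  fix y :: 'a assume y: "y \<in> cball 0 1"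
  obtain b :: 'a where b: "b \<in> Basis"
    using nonempty_Basis by blast
  show "y \<in> {r *\<^sub>R x | r x. 0 \<le> r \<and> r \<le> 1 \<and> x \<in> sphere 0 1}"
  proof (cases "y = 0")
    case True
    \<comment> \<open>The origin has no direction of its own, so a basis vector serves as the unit
      vector.\<close>
    then have "y = 0 *\<^sub>R b \<and> (0::real) \<le> 0 \<and> (0::real) \<le> 1 \<and> b \<in> sphere 0 1"
      using b by (simp add: norm_Basis)
    then show ?thesis
      by blast
  next
    case False
    then have "y = norm y *\<^sub>R (y /\<^sub>R norm y) \<and> 0 \<le> norm y \<and> norm y \<le> 1 \<and> y /\<^sub>R norm y \<in> sphere 0 1"
      using y by (simp add: dist_norm)
    then show ?thesis
      by blast
  qed
qed (auto simp: dist_norm)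

lemma omega_eq: "omega TYPE('n::finite) = real CARD('n) * radial_const TYPE(real ^ 'n)"
  unfolding omega_def sphere_surface_measure_def cone_over_unit_sphere
  by (simp add: radial_const_def content_cball)

lemma norm_magnetic_quotient:
  "norm (magnetic_quotient A s u x y) =
    norm (u x - exp (\<i> * complex_of_real ((x - y) \<bullet> A ((x + y) /\<^sub>R 2))) * u y) / norm (x - y) powr s"
  by (simp add: magnetic_quotient_def norm_divide)

text \<open>Passing to Borel representatives makes the integrand jointly Borel, as Tonelli requires.
  The integrals agree because almost every pair has both points and the midpoint outside
  \<open>N\<close>.\<close>

lemma magnetic_modular_eq_lborel:
  fixes A B :: "real ^ 'n \<Rightarrow> real ^ 'n" and u v :: "real ^ 'n \<Rightarrow> complex"
  assumes N: "N \<in> null_sets lborel" and eq: "\<And>x. x \<notin> N \<Longrightarrow> u x = v x" "\<And>x. x \<notin> N \<Longrightarrow> A x = B x"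
  shows "magnetic_modular A s G u =
    (\<integral>\<^sup>+p. ennreal (G (norm (magnetic_quotient B s v (fst p) (snd p))) / norm (fst p - snd p) ^ CARD('n)) \<partial>lborel)"
  unfolding magnetic_modular_def nn_integral_completion
proof (rule nn_integral_cong_AE)
  show "AE p in lborel. (case p of (x, y) \<Rightarrow> ennreal (G (norm (magnetic_quotient A s u x y)) / norm (x - y) ^ CARD('n))) =
      ennreal (G (norm (magnetic_quotient B s v (fst p) (snd p))) / norm (fst p - snd p) ^ CARD('n))"
    using AE_lborel_pair_avoids[OF N]
    by eventually_elim (auto simp: magnetic_quotient_def eq)
qed

lemma nn_integral_lebesgue_cong_null_set:
  assumes N: "N \<in> null_sets lborel" and "\<And>x. x \<notin> N \<Longrightarrow> f x = g x"
  shows "(\<integral>\<^sup>+x. f x \<partial>lebesgue) = (\<integral>\<^sup>+x. g x \<partial>lborel)"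
  unfolding nn_integral_completion using AE_not_in[OF N] assms(2)
  by (intro nn_integral_cong_AE) (auto elim: eventually_mono)

theorem theorem1p1:
  fixes \<phi> G :: "real \<Rightarrow> real" and pm pp :: real
    and A :: "real ^ 'n \<Rightarrow> real ^ 'n" and u :: "real ^ 'n \<Rightarrow> complex"
  assumes "young_function \<phi> G"
    and "1 \<le> pm"
    and "\<forall>t>0. pm \<le> t * \<phi> t / G t \<and> t * \<phi> t / G t \<le> pp"
    and "magnetic_potential A"
    and "u \<in> (\<Union>s\<in>{0<..<1}. magnetic_space0 A s G)"
  shows "((\<lambda>s. ennreal s * magnetic_modular A s G u) \<longlongrightarrow>
           ennreal (2 * omega TYPE('n) / real CARD('n)) *
             (\<integral>\<^sup>+ x. ennreal (assoc_young G (norm (u x))) \<partial>lebesgue)) (at_right 0)"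
proof -
  note Y = assms(1)
  have lower: "1 \<le> t * \<phi> t / G t" and upper: "t * \<phi> t / G t \<le> pp" if "0 < t" for t
    using assms(2,3) that by force+
  \<comment> \<open>The values of \<open>G\<close> at negative arguments are arbitrary; this
    extension by 0 is monotone on the whole line.\<close>
  define G0 where "G0 t = G (max 0 t)" for t
  have G0: "G0 t = G t" if "0 \<le> t" for t
    using that by (simp add: G0_def)
  interpret G0: doubling G0 pp
  proof
    show "mono G0"
      using young_mono[OF Y] by (auto simp: mono_def G0_def max_def)
    show "G0 0 = 0"
      using young_zero[OF Y] by (simp add: G0)
    show "1 \<le> pp"
      using lower[of 1] upper[of 1] by simp
    show "(1 - pp * (1 - l)) * G0 t \<le> G0 (l * t)" if "0 \<le> l" "l \<le> 1" "0 \<le> t" for l t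
      using young_scaling[OF Y upper that] that by (simp add: G0)
  qed
  have Gbar: "G0.Gbar t = ennreal (assoc_young G t)" if "0 \<le> t" for t
    using assoc_young_eq_nn_integral[OF Y lower that] by (simp add: G0.Gbar_def G0_def)
  have Gbar_le: "G0.Gbar t \<le> ennreal (G0 t)" if t: "0 \<le> t" for t
  proof -
    have "G0.Gbar t = (\<integral>\<^sup>+\<tau>. ennreal (G \<tau> / \<tau>) * indicator {0..t} \<tau> \<partial>lborel)"
      unfolding G0.Gbar_def by (intro nn_integral_cong) (auto simp: G0 indicator_def)
    then show ?thesis
      using nn_integral_young_div_le[OF Y lower t] t by (simp add: G0)
  qed

  \<comment> \<open>Membership in the union supplies an order at which the magnetic modular is
    finite.\<close>
  obtain s0 where s0: "0 < s0" and u: "u \<in> magnetic_space A s0 G"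
    using assms(5) by (auto simp: magnetic_space0_def)
  have um: "u \<in> borel_measurable (completion lborel)" and modular: "modular G u < \<infinity>"
    and seminorm: "magnetic_modular A s0 G u < \<infinity>"
    using u by (auto simp: magnetic_space_def orlicz_class_def)
  have Am: "A \<in> borel_measurable (completion lborel)"
    using assms(4) by (simp add: magnetic_potential_def)
  obtain v where v [measurable]: "v \<in> borel_measurable lborel" and uv: "AE x in lborel. u x = v x"
    using completion_ex_borel_measurable_euclidean[OF um] .
  obtain B where B [measurable]: "B \<in> borel_measurable lborel" and AB: "AE x in lborel. A x = B x"
    using completion_ex_borel_measurable_euclidean[OF Am] .
  have "AE x in lborel. u x = v x \<and> A x = B x"
    using uv AB by eventually_elim simp
  then obtain N where N: "N \<in> null_sets lborel" "{x. \<not> (u x = v x \<and> A x = B x)} \<subseteq> N"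
    unfolding eventually_ae_filter by auto
  then have eq: "u x = v x" "A x = B x" if "x \<notin> N" for x
    using that by auto

  define U where "U x = norm (v x)" for x
  \<comment> \<open>The numerator of the magnetic quotient, which does not involve \<open>s\<close>,
    with \<open>u\<close> and \<open>A\<close> replaced by Borel representatives.\<close>
  define W where "W p = norm (v (fst p) -
      exp (\<i> * complex_of_real ((fst p - snd p) \<bullet> B ((fst p + snd p) /\<^sub>R 2))) * v (snd p))" for p
  have [measurable]: "v \<in> borel_measurable borel" "B \<in> borel_measurable borel"
    using v B by simp_all
  have [measurable]: "U \<in> borel_measurable borel"
    unfolding U_def by measurable
  have [measurable]: "W \<in> borel_measurable borel"
    unfolding W_def borel_prod[symmetric] by measurable
  have modular_eq: "magnetic_modular A s G u =
      (\<integral>\<^sup>+p. ennreal (G0 (W p / norm (fst p - snd p) powr s) / norm (fst p - snd p) ^ DIM(real ^ 'n)) \<partial>lborel)" for s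
    by (subst magnetic_modular_eq_lborel[where B=B and v=v, OF N(1) eq])
      (simp_all add: norm_magnetic_quotient W_def G0)
  have "((\<lambda>s. ennreal s * magnetic_modular A s G u) \<longlongrightarrow>
      ennreal (2 * radial_const TYPE(real ^ 'n)) * (\<integral>\<^sup>+x. G0.Gbar (U x) \<partial>lborel)) (at_right 0)"
    unfolding modular_eq
  proof (rule G0.small_order_limit[OF _ _ _ _ _ _ _ Gbar_le s0])
    \<comment> \<open>The magnetic phase has modulus 1, so the required bounds are the ordinary
      triangle inequalities for a difference.\<close>
    have n: "norm (exp (\<i> * complex_of_real r) * z) = norm z" for r z
      by (simp add: norm_mult)
    show "W p \<le> U (fst p) + U (snd p)" "U (fst p) \<le> W p + U (snd p)" "U (snd p) \<le> W p + U (fst p)" for p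
      unfolding W_def U_def
      by (metis n norm_triangle_ineq4, metis n norm_triangle_sub add.commute,
          metis n norm_triangle_sub add.commute norm_minus_commute)
    show "(\<integral>\<^sup>+x. ennreal (G0 (U x)) \<partial>lborel) < \<infinity>"
      using modular nn_integral_lebesgue_cong_null_set[OF N(1), of "\<lambda>x. ennreal (G (norm (u x)))" "\<lambda>x. ennreal (G0 (U x))"]
      by (simp add: modular_def eq U_def G0)
    show "(\<integral>\<^sup>+p. ennreal (G0 (W p / norm (fst p - snd p) powr s0) / norm (fst p - snd p) ^ DIM(real ^ 'n)) \<partial>lborel) < \<infinity>"
      using seminorm unfolding modular_eq .
  qed (auto simp: U_def)
  moreover have "(\<integral>\<^sup>+x. ennreal (assoc_young G (norm (u x))) \<partial>lebesgue) = (\<integral>\<^sup>+x. G0.Gbar (U x) \<partial>lborel)"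
    by (rule nn_integral_lebesgue_cong_null_set[OF N(1)]) (simp add: eq U_def Gbar)
  ultimately show ?thesis
    by (simp add: omega_eq)
qed

end
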